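(* Let $D=\mathbb{Q}[x_1,x_2,r,a,b,c,d]$ be the polynomial ring in $7$ variables over $\mathbb{Q}$, let $$I=\langle cr-ax_1,\ cx_2-d-bx_1,\ rd,\ ax_2-br,\ ca-rx_1,\ r^2-a^2,\ rx_2-ab\rangle,$$ let $R=D/I$ (a Noetherian ring), and let $\overline{r}$ denote the image of $r$ in $R$. Then the principal ideal $R\overline{r}$ is not a $w$-ideal of $R$.
   Context: A finitely generated ideal $J$ of a commutative ring $R$ is a GV-ideal if the natural homomorphism $R\to \mathrm{Hom}_R(J,R)$, $s\mapsto (x\mapsto sx)$, is an isomorphism; $\mathrm{GV}(R)$ is the set of GV-ideals. An $R$-module $M$ is GV-torsion-free if no nonzero $x\in M$ satisfies $Jx=0$ for some $J\in\mathrm{GV}(R)$. A GV-torsion-free $R$-module $M$ is a $w$-module if $\mathrm{Ext}^1_R(R/J,M)=0$ for all $J\in\mathrm{GV}(R)$. A $w$-ideal of $R$ is an ideal of $R$ that is a $w$-module. *)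

theory Defs
  imports
    "HOL-Algebra.Module"
    "HOL-Algebra.QuotRing"
    "HOL-Algebra.Ring_Divisibility"
    "HOL-Algebra.Elementary_Groups"
    "HOL-Algebra.Algebraic_Closure_Type"
    "HOL-Library.Poly_Mapping"
begin

section \<open>Modules: homomorphisms, ideals, quotients\<close>

text \<open>The record of modules extends that of rings, but the locale of modules does not refer to
  its fields for a multiplication and a unit. Where there is no natural choice,
  they are left undefined.\<close>

definition mod_hom ::
  "('r, 'k) ring_scheme \<Rightarrow> ('r, 'a, 'm) module_scheme \<Rightarrow> ('r, 'b, 'n) module_scheme \<Rightarrow> ('a \<Rightarrow> 'b) set"
  where "mod_hom R M N =
    {h \<in> carrier M \<rightarrow>\<^sub>E carrier N.
       (\<forall>x\<in>carrier M. \<forall>y\<in>carrier M. h (x \<oplus>\<^bsub>M\<^esub> y) = h x \<oplus>\<^bsub>N\<^esub> h y) \<and>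
       (\<forall>s\<in>carrier R. \<forall>x\<in>carrier M. h (s \<odot>\<^bsub>M\<^esub> x) = s \<odot>\<^bsub>N\<^esub> h x)}"

definition mod_iso ::
  "('r, 'k) ring_scheme \<Rightarrow> ('r, 'a, 'm) module_scheme \<Rightarrow> ('r, 'b, 'n) module_scheme \<Rightarrow> ('a \<Rightarrow> 'b) set"
  where "mod_iso R M N = {h \<in> mod_hom R M N. bij_betw h (carrier M) (carrier N)}"

definition Hom_module ::
  "('r, 'k) ring_scheme \<Rightarrow> ('r, 'a, 'm) module_scheme \<Rightarrow> ('r, 'b, 'n) module_scheme \<Rightarrow>
    ('r, 'a \<Rightarrow> 'b) module"
  where "Hom_module R M N =
    \<lparr>carrier = mod_hom R M N, monoid.mult = undefined, one = undefined,
     zero = (\<lambda>x\<in>carrier M. \<zero>\<^bsub>N\<^esub>),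
     add = (\<lambda>f g. \<lambda>x\<in>carrier M. f x \<oplus>\<^bsub>N\<^esub> g x),
     module.smult = (\<lambda>s f. \<lambda>x\<in>carrier M. s \<odot>\<^bsub>N\<^esub> f x)\<rparr>"

definition self_module :: "('r, 'k) ring_scheme \<Rightarrow> ('r, 'r) module"
  where "self_module R =
    \<lparr>carrier = carrier R, monoid.mult = monoid.mult R, one = \<one>\<^bsub>R\<^esub>, zero = \<zero>\<^bsub>R\<^esub>,
     add = add R, module.smult = monoid.mult R\<rparr>"

definition ideal_module :: "('r, 'k) ring_scheme \<Rightarrow> 'r set \<Rightarrow> ('r, 'r) module"
  where "ideal_module R J = (self_module R)\<lparr>carrier := J\<rparr>"

definition quotient_module :: "('r, 'k) ring_scheme \<Rightarrow> 'r set \<Rightarrow> ('r, 'r set) module"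
  where "quotient_module R J =
    \<lparr>carrier = carrier (R Quot J), monoid.mult = monoid.mult (R Quot J), one = \<one>\<^bsub>R Quot J\<^esub>,
     zero = \<zero>\<^bsub>R Quot J\<^esub>, add = add (R Quot J),
     module.smult = (\<lambda>s Y. (J +>\<^bsub>R\<^esub> s) \<otimes>\<^bsub>R Quot J\<^esub> Y)\<rparr>"

section \<open>Ext of degree one\<close>

definition free_module :: "('r, 'k) ring_scheme \<Rightarrow> 'a set \<Rightarrow> ('r, 'a \<Rightarrow> 'r) module"
  where "free_module R Y =
    \<lparr>carrier = {f \<in> Y \<rightarrow>\<^sub>E carrier R. finite {x \<in> Y. f x \<noteq> \<zero>\<^bsub>R\<^esub>}},
     monoid.mult = undefined, one = undefined,
     zero = (\<lambda>x\<in>Y. \<zero>\<^bsub>R\<^esub>),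
     add = (\<lambda>f g. \<lambda>x\<in>Y. f x \<oplus>\<^bsub>R\<^esub> g x),
     module.smult = (\<lambda>s f. \<lambda>x\<in>Y. s \<otimes>\<^bsub>R\<^esub> f x)\<rparr>"

definition free_cover :: "('r, 'k) ring_scheme \<Rightarrow> ('r, 'a, 'm) module_scheme \<Rightarrow> ('r, 'a \<Rightarrow> 'r) module"
  where "free_cover R M = free_module R (carrier M)"

definition cover_map ::
  "('r, 'k) ring_scheme \<Rightarrow> ('r, 'a, 'm) module_scheme \<Rightarrow> ('a \<Rightarrow> 'r) \<Rightarrow> 'a"
  where "cover_map R M =
    (\<lambda>f\<in>carrier (free_cover R M). \<Oplus>\<^bsub>M\<^esub>x\<in>{x \<in> carrier M. f x \<noteq> \<zero>\<^bsub>R\<^esub>}. f x \<odot>\<^bsub>M\<^esub> x)"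

definition syzygy :: "('r, 'k) ring_scheme \<Rightarrow> ('r, 'a, 'm) module_scheme \<Rightarrow> ('r, 'a \<Rightarrow> 'r) module"
  where "syzygy R M =
    (free_cover R M)\<lparr>carrier := {f \<in> carrier (free_cover R M). cover_map R M f = \<zero>\<^bsub>M\<^esub>}\<rparr>"

text \<open>With \<open>K\<^sub>0 = syzygy R N\<close> and \<open>K\<^sub>1 = syzygy R K\<^sub>0\<close>, the maps
  \<open>free_cover R K\<^sub>1 \<rightarrow> free_cover R K\<^sub>0 \<rightarrow> free_cover R N \<rightarrow> N \<rightarrow> 0\<close>
  begin a free resolution of \<open>N\<close> (each syzygy module is included in the free module that covers the
  previous one). \<open>Ext\<^sup>1(N, M)\<close> is the cohomology in degree one after application
  of \<open>Hom(-, M)\<close>. A fixed resolution suffices, because all of them give isomorphic groups.\<close>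

definition Ext1 ::
  "('r, 'k) ring_scheme \<Rightarrow> ('r, 'a, 'm) module_scheme \<Rightarrow> ('r, 'b, 'n) module_scheme \<Rightarrow>
    ((('a \<Rightarrow> 'r) \<Rightarrow> 'r) \<Rightarrow> 'b) set monoid"
  where "Ext1 R N M =
    (let K\<^sub>0 = syzygy R N;
         K\<^sub>1 = syzygy R K\<^sub>0;
         F\<^sub>0 = free_cover R N;
         F\<^sub>1 = free_cover R K\<^sub>0;
         F\<^sub>2 = free_cover R K\<^sub>1;
         d\<^sub>1 = cover_map R K\<^sub>0;
         d\<^sub>2 = cover_map R K\<^sub>1;
         Z = {f \<in> mod_hom R F\<^sub>1 M. compose (carrier F\<^sub>2) f d\<^sub>2 = \<zero>\<^bsub>Hom_module R F\<^sub>2 M\<^esub>};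
         B = (\<lambda>g. compose (carrier F\<^sub>1) g d\<^sub>1) ` mod_hom R F\<^sub>0 M
     in (Hom_module R F\<^sub>1 M)\<lparr>carrier := Z\<rparr> A_Mod B)"

section \<open>GV-ideals and w-modules\<close>

definition GV :: "('r, 'k) ring_scheme \<Rightarrow> 'r set set"
  where "GV R =
    {J. ideal J R \<and> (\<exists>A \<subseteq> carrier R. finite A \<and> J = Idl\<^bsub>R\<^esub> A) \<and>
        (\<lambda>s\<in>carrier R. \<lambda>x\<in>J. s \<otimes>\<^bsub>R\<^esub> x)
          \<in> mod_iso R (self_module R) (Hom_module R (ideal_module R J) (self_module R))}"

definition GV_torsion_free :: "('r, 'k) ring_scheme \<Rightarrow> ('r, 'a, 'm) module_scheme \<Rightarrow> bool"
  where "GV_torsion_free R M \<longleftrightarrow>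
    \<not> (\<exists>x\<in>carrier M. x \<noteq> \<zero>\<^bsub>M\<^esub> \<and> (\<exists>J\<in>GV R. \<forall>j\<in>J. j \<odot>\<^bsub>M\<^esub> x = \<zero>\<^bsub>M\<^esub>))"

definition w_module :: "('r, 'k) ring_scheme \<Rightarrow> ('r, 'a, 'm) module_scheme \<Rightarrow> bool"
  where "w_module R M \<longleftrightarrow>
    module R M \<and> GV_torsion_free R M \<and>
    (\<forall>J\<in>GV R. trivial_group (Ext1 R (quotient_module R J) M))"

definition w_ideal :: "('r, 'k) ring_scheme \<Rightarrow> 'r set \<Rightarrow> bool"
  where "w_ideal R K \<longleftrightarrow> ideal K R \<and> w_module R (ideal_module R K)"

section \<open>The polynomial ring in seven variables and its quotient\<close>

datatype indet = Ix1 | Ix2 | Ir | Ia | Ib | Ic | Id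

text \<open>Monomials are finitely supported exponent vectors, polynomials are finitely supported
  functions from monomials to coefficients; their product is the convolution product.\<close>

type_synonym poly7 = "(indet \<Rightarrow>\<^sub>0 nat) \<Rightarrow>\<^sub>0 rat"

definition Var :: "indet \<Rightarrow> poly7"
  where "Var v = Poly_Mapping.single (Poly_Mapping.single v 1) 1"

definition D_ring :: "poly7 ring"
  where "D_ring = ring_of_type_algebra"

definition I_ideal :: "poly7 set"
  where "I_ideal =
    (let x\<^sub>1 = Var Ix1; x\<^sub>2 = Var Ix2; r = Var Ir; a = Var Ia; b = Var Ib; c = Var Ic; d = Var Id
     in Idl\<^bsub>D_ring\<^esub>
         {c * r - a * x\<^sub>1, c * x\<^sub>2 - d - b * x\<^sub>1, r * d, a * x\<^sub>2 - b * r,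
          c * a - r * x\<^sub>1, r\<^sup>2 - a\<^sup>2, r * x\<^sub>2 - a * b})"

definition R_ring :: "poly7 set ring"
  where "R_ring = D_ring Quot I_ideal"

definition r_bar :: "poly7 set"
  where "r_bar = I_ideal +>\<^bsub>D_ring\<^esub> Var Ir"

end

theory Submission
  imports Defs
begin

text \<open>If \<open>K\<close> is a \<open>w\<close>-ideal, \<open>J \<in> GV(R)\<close> and \<open>J s \<subseteq> K\<close>, then \<open>s \<in> K\<close>. Here \<open>ab = r x\<^sub>2\<close> and \<open>ac = r x\<^sub>1\<close>
  in \<open>R\<close>, so \<open>(b, c) a \<subseteq> (r)\<close>, while \<open>a \<notin> (r)\<close>; and \<open>(b, c)\<close> is a GV-ideal because \<open>c, b\<close> is a regular
  sequence. For the latter, put \<open>u = r + a\<close> and \<open>v = r - a\<close>: the relations become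
  \<open>uv = u(c - x\<^sub>1) = u(b - x\<^sub>2) = v(c + x\<^sub>1) = v(b + x\<^sub>2) = 0\<close> (with \<open>d = c x\<^sub>2 - b x\<^sub>1\<close>), so \<open>I\<close> is the
  intersection of three prime ideals, the kernels of endomorphisms of \<open>D\<close> which all fix \<open>b\<close> and \<open>c\<close>.\<close>

section \<open>Hilbert's basis theorem\<close>

text \<open>An intersection of primes settles that \<open>c\<close> is regular, but not that
  \<open>b\<close> is regular modulo \<open>c\<close>: quotients by \<open>c\<close> found
  separately on the three components need not come from one element of \<open>R\<close>. The glueing
  comes from an explicit splitting \<open>f = \<pi>\<^sub>1 f + (r + a) h + (r - a) k\<close> modulo
  \<open>I\<close>. Here \<open>r + a\<close> goes to \<open>2 r\<close> under
  \<open>\<pi>\<^sub>2\<close> and to \<open>0\<close> under \<open>\<pi>\<^sub>1\<close> and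
  \<open>\<pi>\<^sub>3\<close>, while \<open>r - a\<close> goes to \<open>2 r\<close> under
  \<open>\<pi>\<^sub>3\<close> and to \<open>0\<close> under the other two. So \<open>h\<close> and
  \<open>k\<close> are determined by the images of \<open>f\<close> up to the factor
  \<open>2 r\<close>, which is coprime to \<open>c\<close>. The same splitting shows that an element
  killed by all three maps lies in \<open>I\<close>. That \<open>a\<close> is not a multiple of
  \<open>r\<close> is a glueing obstruction too: the multiplier would have to be \<open>1\<close> on
  the component \<open>a = r\<close> and \<open>-1\<close> on the component \<open>a = -r\<close>,
  but the origin lies on both. The claim includes that \<open>R\<close> is Noetherian, whence
  Hilbert's theorem.\<close>

lemma decseq_nat_eventually_const:
  fixes s :: "nat \<Rightarrow> nat"
  assumes "decseq s"
  obtains N where "\<And>n. n \<ge> N \<Longrightarrow> s n = s N"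
proof -
  obtain N where "\<And>n. s N \<le> s n"
    using ex_has_least_nat[of "\<lambda>_. True" 0 s] by auto
  with assms have "\<And>n. n \<ge> N \<Longrightarrow> s n = s N"
    by (intro order_antisym) (auto dest: decseqD)
  with that show ?thesis .
qed

text \<open>One coordinate at a time: a sequence of naturals has a monotone subsequence, and if that
  one decreases it is eventually constant, so a tail of it is increasing. Passing to a further
  subsequence keeps the earlier coordinates increasing.\<close>

lemma exists_subseq_incseq:
  fixes f :: "nat \<Rightarrow> 'a \<Rightarrow> nat"
  assumes "finite V"
  shows "\<exists>g. strict_mono (g :: nat \<Rightarrow> nat) \<and> (\<forall>v\<in>V. incseq (\<lambda>n. f (g n) v))"
  using assms
proof (induction V rule: finite_induct)
  case empty
  then show ?case by (auto intro: exI[of _ id] simp: strict_mono_def)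
next
  case (insert v V)
  then obtain g :: "nat \<Rightarrow> nat" where g: "strict_mono g" "\<forall>v\<in>V. incseq (\<lambda>n. f (g n) v)"
    by blast
  obtain h :: "nat \<Rightarrow> nat" where h: "strict_mono h" "monoseq (\<lambda>n. f (g (h n)) v)"
    using seq_monosub[of "\<lambda>n. f (g n) v"] by auto
  obtain N where N: "incseq (\<lambda>n. f (g (h (n + N))) v)"
  proof (cases "incseq (\<lambda>n. f (g (h n)) v)")
    case True
    then show ?thesis using that[of 0] by simp
  next
    case False
    with h have "decseq (\<lambda>n. f (g (h n)) v)"
      by (auto simp: monoseq_def incseq_def decseq_def)
    then obtain N where "\<And>n. n \<ge> N \<Longrightarrow> f (g (h n)) v = f (g (h N)) v"
      using decseq_nat_eventually_const[of "\<lambda>n. f (g (h n)) v"] by blast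
    then have "f (g (h (m + N))) v \<le> f (g (h (n + N))) v" for m n
      by (metis le_add2 order_refl)
    then show ?thesis using that[of N] by (auto simp: incseq_def)
  qed
  have sm: "strict_mono (\<lambda>n. h (n + N))"
    using h(1) by (auto simp: strict_mono_def)
  have "incseq (\<lambda>n. f (g (h (n + N))) w)" if "w \<in> V" for w
    using g(2) that strict_mono_less_eq[OF sm] unfolding incseq_def by blast
  with N have "\<forall>w\<in>insert v V. incseq (\<lambda>n. f (g (h (n + N))) w)" by blast
  moreover have "strict_mono (\<lambda>n. g (h (n + N)))"
    using g(1) sm by (auto simp: strict_mono_def)
  ultimately show ?case by blast
qed

text \<open>Exponent vectors are written additively, so the conclusion says that the monomial
  \<open>m i\<close> divides the later monomial \<open>m j\<close>.\<close>

lemma dickson: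
  fixes m :: "nat \<Rightarrow> 'a::finite \<Rightarrow>\<^sub>0 nat"
  obtains i j k where "i < j" "m j = m i + k"
proof -
  obtain g :: "nat \<Rightarrow> nat" where g: "strict_mono g" "\<And>v. incseq (\<lambda>n. Poly_Mapping.lookup (m (g n)) v)"
    using exists_subseq_incseq[of UNIV "\<lambda>n. Poly_Mapping.lookup (m n)"] by auto
  have "Poly_Mapping.lookup (m (g 0)) v \<le> Poly_Mapping.lookup (m (g 1)) v" for v
    using g(2)[of v] by (simp add: incseq_def)
  then have "m (g 1) = m (g 0) + (m (g 1) - m (g 0))"
    by (intro poly_mapping_eqI) (simp add: lookup_add lookup_minus)
  moreover have "g 0 < g 1" using g(1) by (simp add: strict_mono_def)
  ultimately show ?thesis using that by blast
qed

lemma monomial_nonneg: "0 \<le> (k :: 'a::linorder \<Rightarrow>\<^sub>0 nat)"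
proof (rule leI)
  show "\<not> k < 0" by transfer (simp add: less_fun_def)
qed

text \<open>An infinite descent would contain, by Dickson's lemma, a later monomial divisible by an
  earlier one; but a multiple is never smaller in a monomial order.\<close>

lemma wf_monomial_less: "wf {(m, n :: 'a::{finite,linorder} \<Rightarrow>\<^sub>0 nat). m < n}"
proof (subst wf_iff_no_infinite_down_chain, rule notI)
  assume "\<exists>f. \<forall>i. (f (Suc i), f i) \<in> {(m, n :: 'a \<Rightarrow>\<^sub>0 nat). m < n}"
  then obtain f :: "nat \<Rightarrow> 'a \<Rightarrow>\<^sub>0 nat" where f: "\<And>i. f (Suc i) < f i" by auto
  obtain i j k where ij: "i < j" "f j = f i + k" using dickson[of f] .
  have "f j < f i"
    using ij(1) by (induction rule: less_Suc_induct) (use f in \<open>auto intro: less_trans\<close>)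
  moreover have "f i \<le> f j"
    using add_left_mono[OF monomial_nonneg[of k], of "f i"] ij(2) by simp
  ultimately show False by simp
qed

lemma lookup_single_mult_add:
  fixes p :: "('a::cancel_comm_monoid_add) \<Rightarrow>\<^sub>0 'b::semiring_0"
  shows "Poly_Mapping.lookup (Poly_Mapping.single k c * p) (k + m) = c * Poly_Mapping.lookup p m"
  by (simp add: lookup_mult lookup_single when_mult)

section \<open>Ideals of a ring given by a type class\<close>

lemma ring_of_type_algebra_simps [simp]:
  "carrier ring_of_type_algebra = UNIV"
  "\<zero>\<^bsub>ring_of_type_algebra\<^esub> = 0"
  "\<one>\<^bsub>ring_of_type_algebra\<^esub> = 1"
  "x \<oplus>\<^bsub>ring_of_type_algebra\<^esub> y = x + y"
  "x \<otimes>\<^bsub>ring_of_type_algebra\<^esub> y = x * y"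
  by (simp_all add: ring_of_type_algebra_def)

lemma ring_of_type_algebra_a_inv [simp]: "\<ominus>\<^bsub>ring_of_type_algebra\<^esub> x = - (x :: 'a::comm_ring_1)"
proof -
  interpret ring "ring_of_type_algebra :: 'a ring" by (rule ring_from_type_algebra)
  show ?thesis by (rule minus_equality) simp_all
qed

lemma ideal_ring_of_type_algebraD:
  assumes "ideal I (ring_of_type_algebra :: 'a::comm_ring_1 ring)"
  shows "0 \<in> I" "x \<in> I \<Longrightarrow> y \<in> I \<Longrightarrow> x + y \<in> I" "x \<in> I \<Longrightarrow> y \<in> I \<Longrightarrow> x - y \<in> I"
    "x \<in> I \<Longrightarrow> - x \<in> I" "x \<in> I \<Longrightarrow> z * x \<in> I" "x \<in> I \<Longrightarrow> x * z \<in> I"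
proof -
  interpret ideal I "ring_of_type_algebra :: 'a ring" by fact
  note sg = additive_subgroup.zero_closed[OF is_additive_subgroup]
    additive_subgroup.a_closed[OF is_additive_subgroup]
  show "0 \<in> I" using sg(1) by simp
  show *: "x + y \<in> I" if "x \<in> I" "y \<in> I" for x y using sg(2)[OF that] by simp
  show **: "- x \<in> I" if "x \<in> I" for x using I_l_closed[OF that, of "- 1"] by simp
  show "x - y \<in> I" if "x \<in> I" "y \<in> I" using *[OF that(1) **[OF that(2)]] by simp
  show "z * x \<in> I" if "x \<in> I" using I_l_closed[OF that, of z] by simp
  show "x * z \<in> I" if "x \<in> I" using I_r_closed[OF that, of z] by simp
qed

text \<open>If \<open>I\<close> were not finitely generated, one could keep choosing
  \<open>f n\<close> in \<open>I\<close>, outside the ideal of the earlier choices, with minimal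
  leading monomial. Dickson's lemma then yields \<open>i < j\<close> such that the leading monomial
  of \<open>f i\<close> divides that of \<open>f j\<close>; cancelling the leading term of
  \<open>f j\<close> gives a smaller candidate at stage \<open>j\<close>.\<close>

theorem hilbert_basis:
  "noetherian_ring
    (ring_of_type_algebra :: (('a::{finite,linorder} \<Rightarrow>\<^sub>0 nat) \<Rightarrow>\<^sub>0 'b::field) ring)"
    (is "noetherian_ring ?D")
proof -
  interpret D: ring ?D by (rule ring_from_type_algebra)
  let ?lm = "\<lambda>p :: ('a \<Rightarrow>\<^sub>0 nat) \<Rightarrow>\<^sub>0 'b. Max (Poly_Mapping.keys p)"
  show ?thesis
  proof (rule D.noetherian_ringI, rule ccontr)
    fix I :: "(('a \<Rightarrow>\<^sub>0 nat) \<Rightarrow>\<^sub>0 'b) set"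
    assume I: "ideal I ?D"
      and not_fg: "\<not> (\<exists>A\<subseteq>carrier ?D. finite A \<and> I = Idl\<^bsub>?D\<^esub> A)"
    note I_simps = ideal_ring_of_type_algebraD[OF I]
    have "\<exists>p. p \<in> I \<and> p \<notin> Idl\<^bsub>?D\<^esub> A \<and>
        (\<forall>q. q \<in> I \<and> q \<notin> Idl\<^bsub>?D\<^esub> A \<longrightarrow> \<not> ?lm q < ?lm p)" if "finite A" "A \<subseteq> I" for A
    proof -
      have "Idl\<^bsub>?D\<^esub> A \<subseteq> I" using D.genideal_minimal[OF I that(2)] .
      moreover have "Idl\<^bsub>?D\<^esub> A \<noteq> I" using not_fg that by auto
      ultimately obtain p0 where p0: "p0 \<in> I \<and> p0 \<notin> Idl\<^bsub>?D\<^esub> A" by blast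
      have wf: "wf (inv_image {(m, n :: 'a \<Rightarrow>\<^sub>0 nat). m < n} ?lm)"
        using wf_monomial_less by (rule wf_inv_image)
      obtain z where z: "z \<in> I - Idl\<^bsub>?D\<^esub> A"
        "\<And>y. (y, z) \<in> inv_image {(m, n :: 'a \<Rightarrow>\<^sub>0 nat). m < n} ?lm \<Longrightarrow> y \<notin> I - Idl\<^bsub>?D\<^esub> A"
        using wfE_min[OF wf, of p0 "I - Idl\<^bsub>?D\<^esub> A"] p0 by blast
      show ?thesis
        using z by (intro exI[of _ z]) (auto simp: in_inv_image)
    qed
    then obtain p where p: "\<And>A. finite A \<Longrightarrow> A \<subseteq> I \<Longrightarrow> p A \<in> I \<and> p A \<notin> Idl\<^bsub>?D\<^esub> A \<and>
        (\<forall>q. q \<in> I \<and> q \<notin> Idl\<^bsub>?D\<^esub> A \<longrightarrow> \<not> ?lm q < ?lm (p A))"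
      by metis
    \<comment> \<open>\<open>S n\<close> collects the first \<open>n\<close> choices, so every
      \<open>f i\<close> with \<open>i < n\<close> lies in it.\<close>
    define S where "S = rec_nat {} (\<lambda>_ A. insert (p A) A)"
    have S_0: "S 0 = {}" and S_Suc: "S (Suc n) = insert (p (S n)) (S n)" for n
      by (simp_all add: S_def)
    have S: "finite (S n) \<and> S n \<subseteq> I" for n
      by (induction n) (use p in \<open>auto simp: S_0 S_Suc\<close>)
    define f where "f n = p (S n)" for n
    have f_I: "f n \<in> I" and f_Idl: "f n \<notin> Idl\<^bsub>?D\<^esub> (S n)"
      and f_min: "q \<in> I \<Longrightarrow> q \<notin> Idl\<^bsub>?D\<^esub> (S n) \<Longrightarrow> \<not> ?lm q < ?lm (f n)" for n q
      using p S unfolding f_def by blast+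
    have f_S: "f i \<in> S j" if "i < j" for i j
      using that by (induction j) (auto simp: S_Suc f_def less_Suc_eq)
    have Idl: "ideal (Idl\<^bsub>?D\<^esub> (S n)) ?D" for n
      by (rule D.genideal_ideal) simp
    have f_nz: "f n \<noteq> 0" for n
      using f_Idl[of n] ideal_ring_of_type_algebraD(1)[OF Idl[of n]] by auto
    then have keys_ne: "Poly_Mapping.keys (f n) \<noteq> {}" for n by simp
    obtain i j k where ij: "i < j" and lm: "?lm (f j) = ?lm (f i) + k"
      using dickson[of "\<lambda>n. ?lm (f n)"] .
    \<comment> \<open>\<open>c\<close> and \<open>k\<close> are the coefficient and the monomial of
      the quotient of the two leading terms, so that \<open>t\<close> and \<open>f j\<close> have
      the same leading term.\<close>
    define c where "c = Poly_Mapping.lookup (f j) (?lm (f j)) / Poly_Mapping.lookup (f i) (?lm (f i))"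
    define t where "t = Poly_Mapping.single k c * f i"
    define g where "g = f j - t"
    have t_Idl: "t \<in> Idl\<^bsub>?D\<^esub> (S j)"
      unfolding t_def using f_S[OF ij] D.genideal_self[of "S j"]
      by (intro ideal_ring_of_type_algebraD(5)[OF Idl]) auto
    have g_Idl: "g \<notin> Idl\<^bsub>?D\<^esub> (S j)"
    proof
      assume "g \<in> Idl\<^bsub>?D\<^esub> (S j)"
      from ideal_ring_of_type_algebraD(2)[OF Idl this t_Idl] show False
        using f_Idl[of j] by (simp add: g_def)
    qed
    have "g \<in> I" unfolding g_def t_def by (intro I_simps f_I)
    have "g \<noteq> 0" using g_Idl ideal_ring_of_type_algebraD(1)[OF Idl[of j]] by auto
    have "Poly_Mapping.lookup (f i) (?lm (f i)) \<noteq> 0"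
      using Max_in[OF finite_keys keys_ne] by (simp add: in_keys_iff)
    then have g0: "Poly_Mapping.lookup g (?lm (f j)) = 0"
      using lookup_single_mult_add[of k c "f i" "?lm (f i)"]
      by (simp add: g_def t_def lookup_minus lm c_def add.commute)
    \<comment> \<open>Monomials of \<open>t\<close> are shifts by \<open>k\<close> of those of
      \<open>f i\<close>, hence at most \<open>?lm (f j)\<close>; at that monomial itself the
      coefficient of \<open>g\<close> is zero.\<close>
    have "m < ?lm (f j)" if m: "m \<in> Poly_Mapping.keys g" for m
    proof -
      have "m \<in> Poly_Mapping.keys (f j) \<or> m \<in> Poly_Mapping.keys t"
        using m by (auto simp: g_def in_keys_iff lookup_minus)
      then have "m \<le> ?lm (f j)"
      proof
        assume "m \<in> Poly_Mapping.keys t"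
        then obtain n where n: "n \<in> Poly_Mapping.keys (f i)" "m = k + n"
          using keys_mult[of "Poly_Mapping.single k c" "f i"]
          by (auto simp: t_def split: if_splits)
        then show ?thesis using Max_ge[OF finite_keys n(1)] 
          by (simp add: lm add.commute add_left_mono)
      qed simp
      moreover have "m \<noteq> ?lm (f j)" using m g0 by (auto simp: in_keys_iff)
      ultimately show ?thesis by simp
    qed
    then have "?lm g < ?lm (f j)" using \<open>g \<noteq> 0\<close> by simp
    with f_min[OF \<open>g \<in> I\<close> g_Idl] show False by simp
  qed
qed

text \<open>Generators of the preimage of an ideal map to generators of the ideal.\<close>

lemma noetherian_ring_Quot:
  fixes R (structure)
  assumes "noetherian_ring R" and I: "ideal I R"
  shows "noetherian_ring (R Quot I)"
proof -
  interpret noetherian_ring R by fact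
  interpret Q: ring "R Quot I" by (rule ideal.quotient_is_ring[OF I])
  interpret h: ring_hom_ring R "R Quot I" "(+>) I" by (rule ideal.rcos_ring_hom_ring[OF I])
  have surj: "carrier (R Quot I) = (+>) I ` carrier R"
    unfolding FactRing_def using A_RCOSETS_def'[of R I] by auto
  show ?thesis
  proof (rule Q.noetherian_ringI)
    fix K assume K: "ideal K (R Quot I)"
    define L where "L = {x \<in> carrier R. I +> x \<in> K}"
    have "ideal L R" unfolding L_def by (rule h.ideal_vimage[OF K])
    then obtain A where A: "A \<subseteq> carrier R" "finite A" "L = Idl A"
      using finetely_gen by blast
    have "A \<subseteq> L" using A genideal_self by simp
    then have im: "(+>) I ` A \<subseteq> K" by (auto simp: L_def)
    have imc: "(+>) I ` A \<subseteq> carrier (R Quot I)" using A surj by auto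
    let ?G = "Idl\<^bsub>R Quot I\<^esub> ((+>) I ` A)"
    have G: "ideal ?G (R Quot I)" by (rule Q.genideal_ideal[OF imc])
    have "A \<subseteq> {x \<in> carrier R. I +> x \<in> ?G}"
      using A Q.genideal_self[OF imc] by auto
    then have "L \<subseteq> {x \<in> carrier R. I +> x \<in> ?G}"
      unfolding A(3) by (rule genideal_minimal[OF h.ideal_vimage[OF G]])
    moreover have "K \<subseteq> (+>) I ` L"
      using ideal.Icarr[OF K] surj by (auto simp: L_def)
    ultimately have "K \<subseteq> ?G" by auto
    with Q.genideal_minimal[OF K im] have "K = ?G" by auto
    with imc A(2) show "\<exists>A\<subseteq>carrier (R Quot I). finite A \<and> K = Idl\<^bsub>R Quot I\<^esub> A" by blast
  qed
qed

section \<open>Ext and w-ideals\<close>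

lemma mod_homD:
  assumes "h \<in> mod_hom R M N"
  shows "x \<in> carrier M \<Longrightarrow> h x \<in> carrier N"
    "x \<in> carrier M \<Longrightarrow> y \<in> carrier M \<Longrightarrow> h (x \<oplus>\<^bsub>M\<^esub> y) = h x \<oplus>\<^bsub>N\<^esub> h y"
    "s \<in> carrier R \<Longrightarrow> x \<in> carrier M \<Longrightarrow> h (s \<odot>\<^bsub>M\<^esub> x) = s \<odot>\<^bsub>N\<^esub> h x"
    "h \<in> extensional (carrier M)"
  using assms by (auto simp: mod_hom_def PiE_def)

lemma restrict_mod_homI:
  assumes "\<And>x. x \<in> carrier M \<Longrightarrow> h x \<in> carrier N"
    and "\<And>x y. x \<in> carrier M \<Longrightarrow> y \<in> carrier M \<Longrightarrow> h (x \<oplus>\<^bsub>M\<^esub> y) = h x \<oplus>\<^bsub>N\<^esub> h y"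
    and "\<And>s x. s \<in> carrier R \<Longrightarrow> x \<in> carrier M \<Longrightarrow> h (s \<odot>\<^bsub>M\<^esub> x) = s \<odot>\<^bsub>N\<^esub> h x"
    and "module R M"
  shows "restrict h (carrier M) \<in> mod_hom R M N"
proof -
  interpret module R M by fact
  show ?thesis using assms(1-3) by (simp add: mod_hom_def)
qed

lemma mod_hom_zero:
  assumes "h \<in> mod_hom R M N" "module R M" "module R N"
  shows "h \<zero>\<^bsub>M\<^esub> = \<zero>\<^bsub>N\<^esub>"
proof -
  interpret M: module R M by fact
  interpret N: module R N by fact
  have "h (\<zero>\<^bsub>R\<^esub> \<odot>\<^bsub>M\<^esub> \<zero>\<^bsub>M\<^esub>) = \<zero>\<^bsub>R\<^esub> \<odot>\<^bsub>N\<^esub> h \<zero>\<^bsub>M\<^esub>"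
    by (rule mod_homD(3)[OF assms(1)]) auto
  then show ?thesis using mod_homD(1)[OF assms(1)] by simp
qed

lemma mod_hom_kernel_module:
  assumes "h \<in> mod_hom R M N" "module R M" "module R N"
  shows "module R (M\<lparr>carrier := {x \<in> carrier M. h x = \<zero>\<^bsub>N\<^esub>}\<rparr>)"
proof -
  interpret M: module R M by fact
  interpret N: module R N by fact
  \<comment> \<open>A \<open>mod_hom\<close> is only known to respect sums and scalar multiples, so
    negation is read as multiplication by \<open>-1\<close>.\<close>
  have inv: "\<ominus>\<^bsub>M\<^esub> x = (\<ominus>\<^bsub>R\<^esub> \<one>\<^bsub>R\<^esub>) \<odot>\<^bsub>M\<^esub> x" if "x \<in> carrier M" for x
    using that by (simp add: M.smult_l_minus)
  have "submodule {x \<in> carrier M. h x = \<zero>\<^bsub>N\<^esub>} R M"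
    by (rule M.submoduleI)
      (use mod_homD[OF assms(1)] mod_hom_zero[OF assms] in \<open>auto simp: inv\<close>)
  then show ?thesis using submodule.submodule_is_module assms(2) by blast
qed

section \<open>The ring, its ideals, its quotients and free modules as modules\<close>

lemma (in cring) module_self_module: "module R (self_module R)"
  by (rule moduleI)
    (auto simp: self_module_def is_cring l_distr r_distr m_assoc
      intro!: abelian_groupI a_assoc a_comm intro: add.l_inv_ex)

text \<open>\<open>finsum\<close> sees only the additive structure, which the two records
  share.\<close>

lemma finsum_self_module: "finsum (self_module R) f A = finsum R f A"
  by (simp add: finsum_def finprod_def self_module_def)

lemma (in cring) module_ideal_module:
  assumes "ideal J R"
  shows "module R (ideal_module R J)"
proof -
  interpret J: ideal J R by fact
  interpret S: module R "self_module R" by (rule module_self_module)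
  have inv: "\<ominus>\<^bsub>self_module R\<^esub> x = \<ominus> x" for x
    by (simp add: a_inv_def m_inv_def self_module_def)
  have "submodule J R (self_module R)"
    by (rule S.submoduleI)
      (use J.Icarr J.zero_closed J.a_closed J.a_inv_closed J.I_l_closed in
        \<open>auto simp: inv, auto simp: self_module_def\<close>)
  then show ?thesis
    using submodule.submodule_is_module module_self_module
    unfolding ideal_module_def by blast
qed

lemma (in cring) module_quotient_module:
  assumes "ideal J R"
  shows "module R (quotient_module R J)"
proof -
  interpret J: ideal J R by fact
  interpret Q: cring "R Quot J" by (rule J.quotient_is_cring[OF is_cring])
  interpret h: ring_hom_cring R "R Quot J" "(+>) J" by (rule J.rcos_ring_hom_cring[OF is_cring])
  show ?thesis
  proof (rule moduleI)
    show "abelian_group (quotient_module R J)"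
      by (rule abelian_groupI)
        (auto simp: quotient_module_def Q.a_ac intro: Q.add.l_inv_ex)
  qed (use is_cring h.hom_closed in \<open>auto simp: quotient_module_def Q.l_distr Q.r_distr Q.m_assoc\<close>)
qed

lemma finsum_quotient_module: "finsum (quotient_module R J) f A = finsum (R Quot J) f A"
  by (simp add: finsum_def finprod_def quotient_module_def)

lemma zero_quotient_module: "\<zero>\<^bsub>quotient_module R J\<^esub> = J"
  by (simp add: quotient_module_def FactRing_def)

lemma (in ideal) smult_quotient_module:
  assumes "s \<in> carrier R" "x \<in> carrier R"
  shows "s \<odot>\<^bsub>quotient_module R I\<^esub> (I +> x) = I +> (s \<otimes> x)"
  using ring_hom_mult[OF rcos_ring_hom assms] by (simp add: quotient_module_def)

lemma (in cring) module_free_module: "module R (free_module R Y)"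
proof -
  have fin: "finite {x \<in> Y. f x \<oplus> g x \<noteq> \<zero>}"
    if "finite {x \<in> Y. f x \<noteq> \<zero>}" "finite {x \<in> Y. g x \<noteq> \<zero>}" for f g
    by (rule finite_subset[OF _ finite_UnI[OF that]]) auto
  have fin': "finite {x \<in> Y. s \<otimes> f x \<noteq> \<zero>}"
    if "finite {x \<in> Y. f x \<noteq> \<zero>}" "s \<in> carrier R" for f s
    by (rule finite_subset[OF _ that(1)]) (use that(2) in auto)
  have conj: "{x. (x \<in> Y \<longrightarrow> P x) \<and> x \<in> Y} = {x \<in> Y. P x}" for P
    by auto
  show ?thesis
  proof (rule moduleI)
    show "abelian_group (free_module R Y)"
    proof (rule abelian_groupI)
      fix f assume f: "f \<in> carrier (free_module R Y)"
      have "(\<lambda>x\<in>Y. \<ominus> f x) \<in> carrier (free_module R Y)"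
      proof -
        have "finite {x \<in> Y. \<ominus> f x \<noteq> \<zero>}"
          by (rule finite_subset[of _ "{x \<in> Y. f x \<noteq> \<zero>}"])
            (use f in \<open>auto simp: free_module_def\<close>)
        moreover have "{x \<in> Y. (\<lambda>x\<in>Y. \<ominus> f x) x \<noteq> \<zero>} = {x \<in> Y. \<ominus> f x \<noteq> \<zero>}" by auto
        ultimately show ?thesis
          using f by (auto simp: free_module_def PiE_def Pi_def)
      qed
      moreover have "(\<lambda>x\<in>Y. \<ominus> f x) \<oplus>\<^bsub>free_module R Y\<^esub> f = \<zero>\<^bsub>free_module R Y\<^esub>"
        using f by (auto simp: free_module_def fun_eq_iff l_neg PiE_def Pi_def)
      ultimately show "\<exists>y\<in>carrier (free_module R Y).
          y \<oplus>\<^bsub>free_module R Y\<^esub> f = \<zero>\<^bsub>free_module R Y\<^esub>" by blast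
    next
      fix f g assume fg: "f \<in> carrier (free_module R Y)" "g \<in> carrier (free_module R Y)"
      have "{x \<in> Y. (\<lambda>x\<in>Y. f x \<oplus> g x) x \<noteq> \<zero>} = {x \<in> Y. f x \<oplus> g x \<noteq> \<zero>}" by auto
      then show "f \<oplus>\<^bsub>free_module R Y\<^esub> g \<in> carrier (free_module R Y)"
        using fg fin[of f g] by (auto simp: free_module_def PiE_def Pi_def)
    qed (auto simp: free_module_def PiE_def Pi_def fun_eq_iff extensional_def a_ac
        intro: finite_subset[of _ "{}"])
  next
    fix s f assume sf: "s \<in> carrier R" "f \<in> carrier (free_module R Y)"
    have "{x \<in> Y. (\<lambda>x\<in>Y. s \<otimes> f x) x \<noteq> \<zero>} = {x \<in> Y. s \<otimes> f x \<noteq> \<zero>}" by auto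
    then show "s \<odot>\<^bsub>free_module R Y\<^esub> f \<in> carrier (free_module R Y)"
      using sf fin'[of f s] by (auto simp: free_module_def PiE_def Pi_def)
  qed (auto simp: free_module_def PiE_def Pi_def fun_eq_iff extensional_def l_distr r_distr m_assoc is_cring)
qed

text \<open>The linear map out of the free module on \<open>Y\<close> that sends basis elements to
  the family \<open>e\<close>. The identity family gives \<open>cover_map\<close>; a family of coset
  representatives will give a lift of the cover of \<open>R/J\<close> to \<open>R\<close>.\<close>

definition lincomb ::
  "('r, 'k) ring_scheme \<Rightarrow> ('r, 'a, 'm) module_scheme \<Rightarrow> ('i \<Rightarrow> 'a) \<Rightarrow> 'i set \<Rightarrow> ('i \<Rightarrow> 'r) \<Rightarrow> 'a"
  where "lincomb R M e Y f = (\<Oplus>\<^bsub>M\<^esub>x\<in>{x \<in> Y. f x \<noteq> \<zero>\<^bsub>R\<^esub>}. f x \<odot>\<^bsub>M\<^esub> e x)"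

lemma cover_map_eq_lincomb:
  "cover_map R M =
    (\<lambda>f\<in>carrier (free_module R (carrier M)). lincomb R M (\<lambda>x. x) (carrier M) f)"
  by (simp add: cover_map_def free_cover_def lincomb_def)

text \<open>The index set in \<open>lincomb\<close> depends on \<open>f\<close>. To compare several
  functions, the sum is moved to one finite set containing all their supports.\<close>

lemma (in module) lincomb_eq:
  assumes "finite A" "A \<subseteq> Y" "\<And>x. x \<in> Y - A \<Longrightarrow> f x = \<zero>"
    and "f \<in> Y \<rightarrow> carrier R" "e \<in> Y \<rightarrow> carrier M"
  shows "lincomb R M e Y f = (\<Oplus>\<^bsub>M\<^esub>x\<in>A. f x \<odot>\<^bsub>M\<^esub> e x)"
  unfolding lincomb_def
proof (rule M.add.finprod_mono_neutral_cong_left)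
  show "{x \<in> Y. f x \<noteq> \<zero>} \<subseteq> A" using assms(3) by auto
qed (use assms in \<open>auto simp: Pi_def subset_iff\<close>)

lemma (in module) lincomb_mod_hom:
  assumes e: "e \<in> Y \<rightarrow> carrier M"
  shows "restrict (lincomb R M e Y) (carrier (free_module R Y)) \<in> mod_hom R (free_module R Y) M"
proof (rule restrict_mod_homI)
  show "module R (free_module R Y)" by (rule R.module_free_module)
next
  fix f assume "f \<in> carrier (free_module R Y)"
  then show "lincomb R M e Y f \<in> carrier M"
    unfolding lincomb_def using e
    by (intro M.finsum_closed) (auto simp: free_module_def Pi_def)
next
  fix f g assume fg: "f \<in> carrier (free_module R Y)" "g \<in> carrier (free_module R Y)"
  let ?A = "{x \<in> Y. f x \<noteq> \<zero>} \<union> {x \<in> Y. g x \<noteq> \<zero>}"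
  have A: "finite ?A" "?A \<subseteq> Y" using fg by (auto simp: free_module_def)
  have f: "f \<in> Y \<rightarrow> carrier R" and g: "g \<in> Y \<rightarrow> carrier R"
    using fg by (auto simp: free_module_def)
  have c: "f x \<in> carrier R" "g x \<in> carrier R" "e x \<in> carrier M" if "x \<in> ?A" for x
    using that f g e by auto
  have "lincomb R M e Y (f \<oplus>\<^bsub>free_module R Y\<^esub> g)
      = (\<Oplus>\<^bsub>M\<^esub>x\<in>?A. (f \<oplus>\<^bsub>free_module R Y\<^esub> g) x \<odot>\<^bsub>M\<^esub> e x)"
    by (rule lincomb_eq[OF A]) (use f g e in \<open>auto simp: free_module_def\<close>)
  also have "\<dots> = (\<Oplus>\<^bsub>M\<^esub>x\<in>?A. f x \<odot>\<^bsub>M\<^esub> e x \<oplus>\<^bsub>M\<^esub> g x \<odot>\<^bsub>M\<^esub> e x)"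
    by (rule M.finsum_cong')
      (use c A(2) in \<open>auto simp: free_module_def smult_l_distr\<close>)
  also have "\<dots> = (\<Oplus>\<^bsub>M\<^esub>x\<in>?A. f x \<odot>\<^bsub>M\<^esub> e x) \<oplus>\<^bsub>M\<^esub> (\<Oplus>\<^bsub>M\<^esub>x\<in>?A. g x \<odot>\<^bsub>M\<^esub> e x)"
    by (rule M.finsum_addf) (use c in auto)
  also have "(\<Oplus>\<^bsub>M\<^esub>x\<in>?A. f x \<odot>\<^bsub>M\<^esub> e x) = lincomb R M e Y f"
    by (rule lincomb_eq[OF A, symmetric]) (use f e in auto)
  also have "(\<Oplus>\<^bsub>M\<^esub>x\<in>?A. g x \<odot>\<^bsub>M\<^esub> e x) = lincomb R M e Y g"
    by (rule lincomb_eq[OF A, symmetric]) (use g e in auto)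
  finally show "lincomb R M e Y (f \<oplus>\<^bsub>free_module R Y\<^esub> g)
      = lincomb R M e Y f \<oplus>\<^bsub>M\<^esub> lincomb R M e Y g" .
next
  fix s f assume s: "s \<in> carrier R" and f': "f \<in> carrier (free_module R Y)"
  let ?A = "{x \<in> Y. f x \<noteq> \<zero>}"
  have A: "finite ?A" "?A \<subseteq> Y" using f' by (auto simp: free_module_def)
  have f: "f \<in> Y \<rightarrow> carrier R"
    using f' by (auto simp: free_module_def)
  have c: "f x \<in> carrier R" "e x \<in> carrier M" if "x \<in> ?A" for x
    using that f e by auto
  have "lincomb R M e Y (s \<odot>\<^bsub>free_module R Y\<^esub> f)
      = (\<Oplus>\<^bsub>M\<^esub>x\<in>?A. (s \<odot>\<^bsub>free_module R Y\<^esub> f) x \<odot>\<^bsub>M\<^esub> e x)"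
    by (rule lincomb_eq[OF A]) (use s f e in \<open>auto simp: free_module_def\<close>)
  also have "\<dots> = (\<Oplus>\<^bsub>M\<^esub>x\<in>?A. s \<odot>\<^bsub>M\<^esub> (f x \<odot>\<^bsub>M\<^esub> e x))"
    by (rule M.finsum_cong')
      (use s c A(2) in \<open>auto simp: free_module_def smult_assoc1\<close>)
  also have "\<dots> = s \<odot>\<^bsub>M\<^esub> (\<Oplus>\<^bsub>M\<^esub>x\<in>?A. f x \<odot>\<^bsub>M\<^esub> e x)"
    by (rule finsum_smult_ldistr[symmetric]) (use s c A in auto)
  finally show "lincomb R M e Y (s \<odot>\<^bsub>free_module R Y\<^esub> f) = s \<odot>\<^bsub>M\<^esub> lincomb R M e Y f"
    by (simp add: lincomb_def)
qed

lemma (in cring) delta_in_free_module: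
  assumes "a \<in> carrier R"
  shows "(\<lambda>x\<in>Y. if x = y then a else \<zero>) \<in> carrier (free_module R Y)"
proof -
  have "finite {x \<in> Y. (\<lambda>x\<in>Y. if x = y then a else \<zero>) x \<noteq> \<zero>}"
    by (rule finite_subset[of _ "{y}"]) auto
  then show ?thesis using assms by (auto simp: free_module_def)
qed

lemma (in module) lincomb_delta:
  assumes "y \<in> Y" "a \<in> carrier R" "e \<in> Y \<rightarrow> carrier M"
  shows "lincomb R M e Y (\<lambda>x\<in>Y. if x = y then a else \<zero>) = a \<odot>\<^bsub>M\<^esub> e y"
proof -
  have "lincomb R M e Y (\<lambda>x\<in>Y. if x = y then a else \<zero>)
      = (\<Oplus>\<^bsub>M\<^esub>x\<in>{y}. (\<lambda>x\<in>Y. if x = y then a else \<zero>) x \<odot>\<^bsub>M\<^esub> e x)"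
    by (rule lincomb_eq) (use assms in auto)
  also have "\<dots> = a \<odot>\<^bsub>M\<^esub> e y"
    using assms by (subst M.finsum_insert) (auto simp: Pi_def)
  finally show ?thesis .
qed

lemma (in module) cover_map_mod_hom: "cover_map R M \<in> mod_hom R (free_cover R M) M"
  unfolding cover_map_eq_lincomb free_cover_def by (rule lincomb_mod_hom) simp

lemma (in module) module_free_cover: "module R (free_cover R M)"
  unfolding free_cover_def by (rule R.module_free_module)

lemma (in module) module_syzygy: "module R (syzygy R M)"
  unfolding syzygy_def
  by (rule mod_hom_kernel_module[OF cover_map_mod_hom module_free_cover module_axioms])

section \<open>GV-ideals and the vanishing of Ext in degree one\<close>

lemma GV_D:
  assumes "J \<in> GV R"
  shows "ideal J R"
    "s \<in> carrier R \<Longrightarrow> t \<in> carrier R \<Longrightarrow> (\<And>j. j \<in> J \<Longrightarrow> s \<otimes>\<^bsub>R\<^esub> j = t \<otimes>\<^bsub>R\<^esub> j) \<Longrightarrow> s = t"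
proof -
  show "ideal J R" using assms by (simp add: GV_def)
  assume st: "s \<in> carrier R" "t \<in> carrier R" and eq: "\<And>j. j \<in> J \<Longrightarrow> s \<otimes>\<^bsub>R\<^esub> j = t \<otimes>\<^bsub>R\<^esub> j"
  have "inj_on (\<lambda>s\<in>carrier R. \<lambda>x\<in>J. s \<otimes>\<^bsub>R\<^esub> x) (carrier R)"
    using assms by (simp add: GV_def mod_iso_def bij_betw_def self_module_def)
  moreover have "(\<lambda>x\<in>J. s \<otimes>\<^bsub>R\<^esub> x) = (\<lambda>x\<in>J. t \<otimes>\<^bsub>R\<^esub> x)"
    using eq by (auto simp: fun_eq_iff)
  ultimately show "s = t" using st by (auto dest: inj_onD)
qed

text \<open>The coset of the cocycle \<open>f\<close> must be the unit of the quotient group, which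
  is \<open>B\<close> itself. Since the zero map is a coboundary, \<open>f\<close> lies in its own
  coset \<open>B + f = B\<close>.\<close>

lemma trivial_Ext1D:
  fixes R (structure)
  assumes M: "module R M" and N: "module R N" and triv: "trivial_group (Ext1 R N M)"
    and f: "f \<in> mod_hom R (free_cover R (syzygy R N)) M"
    and f0: "\<And>h. h \<in> carrier (free_cover R (syzygy R (syzygy R N))) \<Longrightarrow>
      f (cover_map R (syzygy R (syzygy R N)) h) = \<zero>\<^bsub>M\<^esub>"
  shows "\<exists>g\<in>mod_hom R (free_cover R N) M.
    \<forall>h\<in>carrier (free_cover R (syzygy R N)). f h = g (cover_map R (syzygy R N) h)"
proof -
  interpret M: module R M by fact
  interpret N: module R N by fact
  interpret K0: module R "syzygy R N" by (rule N.module_syzygy)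
  interpret K1: module R "syzygy R (syzygy R N)" by (rule K0.module_syzygy)
  define F0 F1 F2 where "F0 = free_cover R N" and "F1 = free_cover R (syzygy R N)"
    and "F2 = free_cover R (syzygy R (syzygy R N))"
  define d1 d2 where "d1 = cover_map R (syzygy R N)"
    and "d2 = cover_map R (syzygy R (syzygy R N))"
  define Z where "Z = {f \<in> mod_hom R F1 M. compose (carrier F2) f d2 = \<zero>\<^bsub>Hom_module R F2 M\<^esub>}"
  define B where "B = (\<lambda>g. compose (carrier F1) g d1) ` mod_hom R F0 M"
  define H where "H = (Hom_module R F1 M)\<lparr>carrier := Z\<rparr>"
  have Ext: "Ext1 R N M = H A_Mod B"
    unfolding Ext1_def Let_def F0_def F1_def F2_def d1_def d2_def Z_def B_def H_def ..
  have d1: "d1 h \<in> carrier (syzygy R N)" if "h \<in> carrier F1" for h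
    using mod_homD(1)[OF K0.cover_map_mod_hom] that by (simp add: d1_def F1_def)
  have K0_F0: "x \<in> carrier F0" if "x \<in> carrier (syzygy R N)" for x
    using that by (simp add: syzygy_def F0_def)
  have "f \<in> Z"
    using f f0 by (auto simp: Z_def Hom_module_def F1_def F2_def d2_def compose_def)
  then have "B +>\<^bsub>H\<^esub> f \<in> carrier (Ext1 R N M)"
    unfolding Ext A_FactGroup_def' by (auto simp: A_RCOSETS_def' H_def)
  then have B: "B +>\<^bsub>H\<^esub> f = B"
    using triv unfolding trivial_group_def Ext A_FactGroup_def' by auto
  interpret F0: module R F0 unfolding F0_def by (rule N.module_free_cover)
  have "(\<lambda>x\<in>carrier F0. \<zero>\<^bsub>M\<^esub>) \<in> mod_hom R F0 M"
    by (rule restrict_mod_homI) (auto intro: F0.module_axioms)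
  then have "compose (carrier F1) (\<lambda>x\<in>carrier F0. \<zero>\<^bsub>M\<^esub>) d1 \<in> B"
    unfolding B_def by blast
  also have "compose (carrier F1) (\<lambda>x\<in>carrier F0. \<zero>\<^bsub>M\<^esub>) d1 = (\<lambda>x\<in>carrier F1. \<zero>\<^bsub>M\<^esub>)"
    using d1 K0_F0 by (auto simp: compose_def fun_eq_iff)
  finally have "(\<lambda>x\<in>carrier F1. \<zero>\<^bsub>M\<^esub>) \<oplus>\<^bsub>H\<^esub> f \<in> B +>\<^bsub>H\<^esub> f"
    unfolding a_r_coset_def' by blast
  moreover have "(\<lambda>x\<in>carrier F1. \<zero>\<^bsub>M\<^esub>) \<oplus>\<^bsub>H\<^esub> f = f"
    using mod_homD(1,4)[OF f]
    by (auto simp: H_def Hom_module_def F1_def fun_eq_iff extensional_def)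
  ultimately obtain g where "g \<in> mod_hom R F0 M" "f = compose (carrier F1) g d1"
    unfolding B by (auto simp: B_def)
  then show ?thesis
    by (intro bexI[of _ g]) (simp_all add: F0_def F1_def d1_def compose_def)
qed

text \<open>If \<open>J s \<subseteq> K\<close>, then multiplication by \<open>s\<close> is a homomorphism \<open>J \<rightarrow> K\<close>. Lifting the free cover of
  \<open>R/J\<close> along \<open>R \<rightarrow> R/J\<close> turns it into a cocycle, which is a coboundary only if \<open>s \<in> K\<close>.\<close>

lemma (in cring) w_ideal_GV_closed:
  assumes w: "w_ideal R K" and J: "J \<in> GV R" and s: "s \<in> carrier R"
    and sK: "\<And>j. j \<in> J \<Longrightarrow> s \<otimes> j \<in> K"
  shows "s \<in> K"
proof (cases "\<one> = \<zero>")
  case True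
  have "ideal K R" using w by (simp add: w_ideal_def)
  then have "\<zero> \<in> K" by (simp add: additive_subgroup.zero_closed ideal.axioms(1))
  moreover have "s = \<zero>" using True s by (metis l_one l_null)
  ultimately show ?thesis by simp
next
  case False
  have idJ: "ideal J R" by (rule GV_D(1)[OF J])
  interpret J: ideal J R by (rule idJ)
  have idK: "ideal K R" using w by (simp add: w_ideal_def)
  interpret K: ideal K R by (rule idK)
  define N where "N = quotient_module R J"
  define M where "M = ideal_module R K"
  have triv: "trivial_group (Ext1 R N M)"
    using w J by (simp add: w_ideal_def w_module_def N_def M_def)
  have carM: "carrier M = K" by (simp add: M_def ideal_module_def)
  have smM: "r \<odot>\<^bsub>M\<^esub> x = r \<otimes> x" and addM: "x \<oplus>\<^bsub>M\<^esub> y = x \<oplus> y" and zeroM: "\<zero>\<^bsub>M\<^esub> = \<zero>" for r x y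
    by (simp_all add: M_def ideal_module_def self_module_def)
  interpret M: module R M unfolding M_def by (rule module_ideal_module[OF idK])
  interpret N: module R N unfolding N_def by (rule module_quotient_module[OF idJ])
  interpret S: module R "self_module R" by (rule module_self_module)
  interpret F0: module R "free_cover R N" by (rule N.module_free_cover)
  interpret K0: module R "syzygy R N" by (rule N.module_syzygy)
  interpret F1: module R "free_cover R (syzygy R N)" by (rule K0.module_free_cover)
  interpret K1: module R "syzygy R (syzygy R N)" by (rule K0.module_syzygy)
  interpret h: ring_hom_cring R "R Quot J" "(+>) J" by (rule J.rcos_ring_hom_cring[OF is_cring])
  have zeroN: "\<zero>\<^bsub>N\<^esub> = J" unfolding N_def by (rule zero_quotient_module)
  have carN: "carrier N = (+>) J ` carrier R"
    unfolding N_def quotient_module_def FactRing_def using A_RCOSETS_def'[of R J] by auto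
  then have "\<forall>Y\<in>carrier N. \<exists>x. x \<in> carrier R \<and> J +> x = Y" by auto
  from bchoice[OF this] obtain rep
    where rep: "\<And>Y. Y \<in> carrier N \<Longrightarrow> rep Y \<in> carrier R \<and> J +> rep Y = Y" by blast
  \<comment> \<open>\<open>g\<close> lifts the cover of \<open>R/J\<close> along
    \<open>R \<rightarrow> R/J\<close>, sending each basis vector to a representative of its coset.
    It therefore maps the syzygies into \<open>J\<close>.\<close>
  define g where "g = restrict (lincomb R (self_module R) rep (carrier N)) (carrier (free_cover R N))"
  have "rep \<in> carrier N \<rightarrow> carrier (self_module R)"
    using rep by (simp add: self_module_def)
  from S.lincomb_mod_hom[OF this] have g: "g \<in> mod_hom R (free_cover R N) (self_module R)"
    by (simp add: g_def free_cover_def)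
  have g_lift: "J +> g f = cover_map R N f" if f: "f \<in> carrier (free_cover R N)" for f
  proof -
    let ?A = "{Y \<in> carrier N. f Y \<noteq> \<zero>}"
    have fA: "f Y \<in> carrier R" if "Y \<in> carrier N" for Y
      using f that by (auto simp: free_cover_def free_module_def)
    have "J +> g f = J +> (\<Oplus>Y\<in>?A. f Y \<otimes> rep Y)"
      using f by (simp add: g_def lincomb_def finsum_self_module) (simp add: self_module_def)
    also have "\<dots> = (\<Oplus>\<^bsub>R Quot J\<^esub>Y\<in>?A. J +> (f Y \<otimes> rep Y))"
      using fA rep by (subst h.hom_finsum) (auto simp: o_def)
    also have "\<dots> = (\<Oplus>\<^bsub>R Quot J\<^esub>Y\<in>?A. f Y \<odot>\<^bsub>N\<^esub> Y)"
      using fA rep J.smult_quotient_module N.smult_closed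
      by (intro h.S.finsum_cong') (auto simp: N_def quotient_module_def)
    also have "\<dots> = cover_map R N f"
      using f by (simp add: cover_map_def finsum_quotient_module N_def)
    finally show ?thesis .
  qed
  have g_syzygy: "g k \<in> J" if "k \<in> carrier (syzygy R N)" for k
  proof -
    have k: "k \<in> carrier (free_cover R N)" "cover_map R N k = \<zero>\<^bsub>N\<^esub>"
      using that by (auto simp: syzygy_def)
    have "g k \<in> carrier R" using mod_homD(1)[OF g k(1)] by (simp add: self_module_def)
    moreover have "J +> g k = J" using g_lift[OF k(1)] k(2) zeroN by (simp only:)
    ultimately show ?thesis by (rule J.rcos_const_imp_mem)
  qed
  let ?d1 = "cover_map R (syzygy R N)" and ?d2 = "cover_map R (syzygy R (syzygy R N))"
  \<comment> \<open>The values lie in \<open>K\<close> because \<open>g\<close> sends syzygies into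
    \<open>J\<close> and \<open>s J\<close> lies in \<open>K\<close>; \<open>f\<close> is a cocycle
    because \<open>?d1\<close> vanishes on the image of \<open>?d2\<close>.\<close>
  define f where "f = (\<lambda>h\<in>carrier (free_cover R (syzygy R N)). s \<otimes> g (?d1 h))"
  note d1 = mod_homD[OF K0.cover_map_mod_hom]
  note d2 = mod_homD[OF K1.cover_map_mod_hom]
  have K0_F0: "k \<in> carrier (free_cover R N)" if "k \<in> carrier (syzygy R N)" for k
    using that by (simp add: syzygy_def)
  have opsK0: "x \<oplus>\<^bsub>syzygy R N\<^esub> y = x \<oplus>\<^bsub>free_cover R N\<^esub> y"
    "r \<odot>\<^bsub>syzygy R N\<^esub> x = r \<odot>\<^bsub>free_cover R N\<^esub> x"
    "\<zero>\<^bsub>syzygy R N\<^esub> = \<zero>\<^bsub>free_cover R N\<^esub>" for x y r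
    by (simp_all add: syzygy_def)
  have g_add: "g (x \<oplus>\<^bsub>free_cover R N\<^esub> y) = g x \<oplus> g y"
    if "x \<in> carrier (free_cover R N)" "y \<in> carrier (free_cover R N)" for x y
    using mod_homD(2)[OF g that] by (simp add: self_module_def)
  have g_smult: "g (r \<odot>\<^bsub>free_cover R N\<^esub> x) = r \<otimes> g x"
    if "r \<in> carrier R" "x \<in> carrier (free_cover R N)" for x r
    using mod_homD(3)[OF g that] by (simp add: self_module_def)
  have g_zero: "g \<zero>\<^bsub>free_cover R N\<^esub> = \<zero>"
    using mod_hom_zero[OF g N.module_free_cover module_self_module] by (simp add: self_module_def)
  have g_car: "g x \<in> carrier R" if "x \<in> carrier (free_cover R N)" for x
    using mod_homD(1)[OF g that] by (simp add: self_module_def)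
  have f_hom: "f \<in> mod_hom R (free_cover R (syzygy R N)) M"
    unfolding f_def
    by (rule restrict_mod_homI)
      (use s d1(1-3) K0_F0 in \<open>auto simp: carM smM addM opsK0 g_add g_smult g_car r_distr m_lcomm
        intro: sK g_syzygy K0.module_free_cover\<close>)
  have f_cocycle: "f (?d2 h) = \<zero>\<^bsub>M\<^esub>" if "h \<in> carrier (free_cover R (syzygy R (syzygy R N)))" for h
  proof -
    have "?d2 h \<in> carrier (syzygy R (syzygy R N))" using d2(1) that .
    then have "?d2 h \<in> carrier (free_cover R (syzygy R N))" "?d1 (?d2 h) = \<zero>\<^bsub>syzygy R N\<^esub>"
      by (simp_all add: syzygy_def[of R "syzygy R N"])
    then show ?thesis using s by (simp add: f_def opsK0 g_zero zeroM)
  qed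
  obtain g' where g': "g' \<in> mod_hom R (free_cover R N) M"
    and f_g': "\<And>h. h \<in> carrier (free_cover R (syzygy R N)) \<Longrightarrow> f h = g' (?d1 h)"
    using trivial_Ext1D[OF M.module_axioms N.module_axioms triv f_hom f_cocycle] by blast
  \<comment> \<open>\<open>?d1\<close> sends the basis vector at \<open>k\<close> to
    \<open>k\<close>, so every syzygy is a value of \<open>?d1\<close> and the equation for
    \<open>f\<close> can be read on the syzygies.\<close>
  have g'_syzygy: "s \<otimes> g k = g' k" if k: "k \<in> carrier (syzygy R N)" for k
  proof -
    let ?h = "\<lambda>x\<in>carrier (syzygy R N). if x = k then \<one> else \<zero>"
    have h: "?h \<in> carrier (free_cover R (syzygy R N))"
      unfolding free_cover_def by (rule delta_in_free_module) simp
    have "?d1 ?h = k"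
      using h K0.lincomb_delta[of k "carrier (syzygy R N)" \<one> "\<lambda>x. x"] k
      by (simp add: cover_map_eq_lincomb free_cover_def)
    then show ?thesis using f_g'[OF h] h by (simp add: f_def)
  qed
  define Y where "Y = J +> \<one>"
  have Y: "Y \<in> carrier N" unfolding carN Y_def by (rule imageI) simp
  define e where "e = (\<lambda>x\<in>carrier N. if x = Y then \<one> else \<zero>)"
  have e: "e \<in> carrier (free_cover R N)"
    unfolding free_cover_def e_def by (rule delta_in_free_module) simp
  have cover_e: "cover_map R N e = Y"
    using e N.lincomb_delta[of Y "carrier N" \<one> "\<lambda>x. x"] Y
    by (simp add: cover_map_eq_lincomb free_cover_def e_def)
  have u: "J +> g e = J +> \<one>" using g_lift[OF e] cover_e by (simp add: Y_def)
  have g'e: "g' e \<in> K" using mod_homD(1)[OF g' e] by (simp add: carM)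
  \<comment> \<open>\<open>e\<close> lies over the coset of \<open>1\<close> and is in general no
    syzygy, but \<open>j e\<close> is one for \<open>j\<close> in \<open>J\<close>. So
    \<open>s g\<close> and \<open>g'\<close> agree at \<open>e\<close> after multiplication by any
    \<open>j\<close>, and the injectivity in the GV property removes \<open>j\<close>.\<close>
  have cancel: "(s \<otimes> g e) \<otimes> j = g' e \<otimes> j" if j: "j \<in> J" for j
  proof -
    have jR: "j \<in> carrier R" using j J.Icarr by blast
    have "cover_map R N (j \<odot>\<^bsub>free_cover R N\<^esub> e) = j \<odot>\<^bsub>N\<^esub> Y"
      using mod_homD(3)[OF N.cover_map_mod_hom jR e] cover_e by simp
    also have "\<dots> = J +> (j \<otimes> \<one>)"
      unfolding N_def Y_def using jR by (rule J.smult_quotient_module) simp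
    also have "\<dots> = \<zero>\<^bsub>N\<^esub>"
      using jR a_rcos_zero[OF idJ j] zeroN by (simp only: r_one)
    finally have "j \<odot>\<^bsub>free_cover R N\<^esub> e \<in> carrier (syzygy R N)"
      using jR e by (simp add: syzygy_def)
    from g'_syzygy[OF this] have "s \<otimes> (j \<otimes> g e) = j \<otimes> g' e"
      using g_smult[OF jR e] mod_homD(3)[OF g' jR e] by (simp add: smM)
    then show ?thesis
      using s jR g_car[OF e] K.Icarr[OF g'e] by (simp add: m_ac)
  qed
  have "s \<otimes> g e = g' e"
    by (rule GV_D(2)[OF J _ _ cancel]) (use s g_car[OF e] K.Icarr[OF g'e] in auto)
  with g'e have seK: "s \<otimes> g e \<in> K" by simp
  \<comment> \<open>Split \<open>s = s (1 - g e) + s (g e)\<close>: the first summand is in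
    \<open>K\<close> by the assumption \<open>sK\<close>, the second because it equals
    \<open>g' e\<close>.\<close>
  have "\<one> \<ominus> g e \<in> J"
    using quotient_eq_iff_same_a_r_cos[OF idJ one_closed g_car[OF e]] u by blast
  then have "s \<otimes> (\<one> \<ominus> g e) \<in> K" by (rule sK)
  with seK have "s \<otimes> (\<one> \<ominus> g e) \<oplus> s \<otimes> g e \<in> K" by (rule K.a_closed[rotated])
  also have "s \<otimes> (\<one> \<ominus> g e) \<oplus> s \<otimes> g e = s"
    using s g_car[OF e] by algebra
  finally show ?thesis .
qed

text \<open>Regularity of \<open>c\<close> makes \<open>R \<rightarrow> Hom(J, R)\<close> injective.
  For surjectivity, a homomorphism \<phi> satisfies \<open>b \<phi>(c) = c \<phi>(b)\<close>, so
  regularity of \<open>b\<close> modulo \<open>c\<close> gives \<open>\<phi>(c) = c z\<close>; then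
  \<open>c \<phi>(x) = x \<phi>(c) = c z x\<close>, and cancelling \<open>c\<close> shows that
  \<phi> is multiplication by \<open>z\<close>.\<close>

lemma (in cring) GV_regular_sequenceI:
  assumes J: "ideal J R" "A \<subseteq> carrier R" "finite A" "J = Idl A" and bc: "b \<in> J" "c \<in> J"
    and c_regular: "\<And>x. x \<in> carrier R \<Longrightarrow> c \<otimes> x = \<zero> \<Longrightarrow> x = \<zero>"
    and b_regular: "\<And>x y. x \<in> carrier R \<Longrightarrow> y \<in> carrier R \<Longrightarrow> b \<otimes> x = c \<otimes> y \<Longrightarrow>
      \<exists>z\<in>carrier R. x = c \<otimes> z"
  shows "J \<in> GV R"
proof -
  interpret J: ideal J R by fact
  have bcR: "b \<in> carrier R" "c \<in> carrier R" using bc J.Icarr by auto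
  have c_cancel: "x = y" if "x \<in> carrier R" "y \<in> carrier R" "c \<otimes> x = c \<otimes> y" for x y
  proof -
    have "c \<otimes> (x \<ominus> y) = c \<otimes> x \<ominus> c \<otimes> y" using that(1,2) bcR(2) by algebra
    also have "\<dots> = \<zero>" using that bcR(2) by (simp add: r_right_minus_eq)
    finally have "x \<ominus> y = \<zero>" using c_regular that by simp
    then show ?thesis using that r_right_minus_eq by simp
  qed
  let ?IM = "ideal_module R J" and ?S = "self_module R"
  let ?m = "\<lambda>s. \<lambda>x\<in>J. s \<otimes> x"
  have carIM: "carrier ?IM = J" and carS: "carrier ?S = carrier R"
    and ops: "x \<oplus>\<^bsub>?IM\<^esub> y = x \<oplus> y" "r \<odot>\<^bsub>?IM\<^esub> x = r \<otimes> x"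
      "x \<oplus>\<^bsub>?S\<^esub> y = x \<oplus> y" "r \<odot>\<^bsub>?S\<^esub> x = r \<otimes> x" for x y r
    by (simp_all add: ideal_module_def self_module_def)
  have carH: "carrier (Hom_module R ?IM ?S) = mod_hom R ?IM ?S" by (simp add: Hom_module_def)
  have m_hom: "?m s \<in> mod_hom R ?IM ?S" if "s \<in> carrier R" for s
    using that J.Icarr restrict_mod_homI[of ?IM "\<lambda>x. s \<otimes> x" ?S R] module_ideal_module[OF J(1)]
    by (simp add: carIM carS ops r_distr m_lcomm)
  have hom: "restrict ?m (carrier ?S) \<in> mod_hom R ?S (Hom_module R ?IM ?S)"
    by (rule restrict_mod_homI)
      (use m_hom module_self_module J.Icarr in
        \<open>auto simp: carS carH ops Hom_module_def carIM fun_eq_iff l_distr m_assoc\<close>)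
  have inj: "inj_on (restrict ?m (carrier R)) (carrier R)"
  proof (rule inj_onI)
    fix s t assume st: "s \<in> carrier R" "t \<in> carrier R"
      and "restrict ?m (carrier R) s = restrict ?m (carrier R) t"
    then have "?m s c = ?m t c" by simp
    then have "s \<otimes> c = t \<otimes> c" using bc(2) by simp
    then show "s = t" using st bcR(2) c_cancel[of s t] by (simp add: m_comm)
  qed
  have surj: "\<exists>z\<in>carrier R. \<phi> = ?m z" if \<phi>: "\<phi> \<in> mod_hom R ?IM ?S" for \<phi>
  proof -
    have \<phi>R: "\<phi> x \<in> carrier R" if "x \<in> J" for x
      using mod_homD(1)[OF \<phi>] that by (simp add: carIM carS)
    have \<phi>_smult: "\<phi> (r \<otimes> x) = r \<otimes> \<phi> x" if "r \<in> carrier R" "x \<in> J" for r x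
      using mod_homD(3)[OF \<phi>] that by (simp add: carIM ops)
    \<comment> \<open>Both sides are the value of \<phi> at the product of \<open>x\<close> and
      \<open>y\<close>.\<close>
    have swap: "x \<otimes> \<phi> y = y \<otimes> \<phi> x" if "x \<in> J" "y \<in> J" for x y
      using \<phi>_smult[of x y] \<phi>_smult[of y x] that J.Icarr m_comm[of x y] by auto
    obtain z where z: "z \<in> carrier R" "\<phi> c = c \<otimes> z"
      using b_regular[of "\<phi> c" "\<phi> b"] swap[OF bc] \<phi>R bc by auto
    have "\<phi> x = z \<otimes> x" if x: "x \<in> J" for x
    proof (rule c_cancel)
      have "c \<otimes> \<phi> x = x \<otimes> (c \<otimes> z)" using swap[OF bc(2) x] z(2) by simp
      then show "c \<otimes> \<phi> x = c \<otimes> (z \<otimes> x)"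
        using z(1) bcR(2) J.Icarr[OF x] by (simp add: m_ac)
    qed (use \<phi>R x z(1) J.Icarr in auto)
    then have "\<phi> = ?m z"
      using mod_homD(4)[OF \<phi>] by (auto simp: carIM fun_eq_iff extensional_def)
    with z(1) show ?thesis by blast
  qed
  have "restrict ?m (carrier R) ` carrier R = mod_hom R ?IM ?S"
    using m_hom surj by auto
  with inj hom have "restrict ?m (carrier R) \<in> mod_iso R ?S (Hom_module R ?IM ?S)"
    by (simp add: mod_iso_def bij_betw_def carS carH)
  with J show ?thesis unfolding GV_def by blast
qed

section \<open>Substitution endomorphisms of polynomial rings\<close>

lemma poly_mapping_single_induct [case_names zero single add]:
  assumes "P 0" "\<And>m c. P (Poly_Mapping.single m c)" "\<And>p q. P p \<Longrightarrow> P q \<Longrightarrow> P (p + q)"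
  shows "P (p :: 'a \<Rightarrow>\<^sub>0 'b::comm_monoid_add)"
proof (induction p rule: Poly_Mapping.update_induct)
  case const
  show ?case by (rule assms(1))
next
  case (update f a b)
  have "Poly_Mapping.update a b f = f + Poly_Mapping.single a b"
    using update(1)
    by (intro poly_mapping_eqI)
      (auto simp: lookup_update lookup_add lookup_single when_def in_keys_iff)
  then show ?case using assms(2,3) update(3) by metis
qed

lemma single_power:
  "Poly_Mapping.single k (c :: 'b::comm_semiring_1) ^ n
    = Poly_Mapping.single (\<Sum>i<n. k) (c ^ n)"
  by (induction n) (simp_all add: mult_single add.commute)

lemma prod_single:
  "finite V \<Longrightarrow> (\<Prod>v\<in>V. Poly_Mapping.single (k v) (1 :: 'b::comm_semiring_1))
    = Poly_Mapping.single (\<Sum>v\<in>V. k v) 1"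
  by (induction V rule: finite_induct) (simp_all add: mult_single)

lemma monomial_eq_prod_power:
  fixes m :: "'a::finite \<Rightarrow>\<^sub>0 nat"
  shows "Poly_Mapping.single m (c :: 'b::comm_semiring_1) = Poly_Mapping.single 0 c *
    (\<Prod>v\<in>UNIV. Poly_Mapping.single (Poly_Mapping.single v 1) 1 ^ Poly_Mapping.lookup m v)"
proof -
  have "(\<Sum>v\<in>UNIV. \<Sum>i<Poly_Mapping.lookup m v. Poly_Mapping.single v (1::nat)) = m"
    by (intro poly_mapping_eqI) (simp add: lookup_sum lookup_single when_def if_distrib cong: if_cong)
  then show ?thesis
    by (simp add: single_power prod_single mult_single)
qed

lemma poly_var_induct [case_names const var add mult]:
  fixes P :: "(('a::finite \<Rightarrow>\<^sub>0 nat) \<Rightarrow>\<^sub>0 'b::comm_semiring_1) \<Rightarrow> bool"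
  assumes const: "\<And>c. P (Poly_Mapping.single 0 c)"
    and var: "\<And>v. P (Poly_Mapping.single (Poly_Mapping.single v 1) 1)"
    and add: "\<And>p q. P p \<Longrightarrow> P q \<Longrightarrow> P (p + q)"
    and mult: "\<And>p q. P p \<Longrightarrow> P q \<Longrightarrow> P (p * q)"
  shows "P p"
proof (induction p rule: poly_mapping_single_induct)
  case zero
  then show ?case using const[of 0] by simp
next
  case (single m c)
  have one: "P 1" using const[of 1] by simp
  have pow: "P (q ^ n)" if "P q" for q n
    by (induction n) (use one that mult in auto)
  have "P (\<Prod>v\<in>V. Poly_Mapping.single (Poly_Mapping.single v 1) 1 ^ Poly_Mapping.lookup m v)"
    if "finite V" for V
    using that by (induction V rule: finite_induct) (use one pow var mult in auto)
  then show ?case by (subst monomial_eq_prod_power) (intro mult const, simp)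
qed (rule add)

definition poly_subst ::
  "('a::finite \<Rightarrow> ('a \<Rightarrow>\<^sub>0 nat) \<Rightarrow>\<^sub>0 'b::comm_semiring_1) \<Rightarrow>
    (('a \<Rightarrow>\<^sub>0 nat) \<Rightarrow>\<^sub>0 'b) \<Rightarrow> (('a \<Rightarrow>\<^sub>0 nat) \<Rightarrow>\<^sub>0 'b)"
  where "poly_subst \<sigma> p = (\<Sum>m\<in>Poly_Mapping.keys p.
    Poly_Mapping.single 0 (Poly_Mapping.lookup p m) * (\<Prod>v\<in>UNIV. \<sigma> v ^ Poly_Mapping.lookup m v))"

lemma poly_subst_single:
  "poly_subst \<sigma> (Poly_Mapping.single m c)
    = Poly_Mapping.single 0 c * (\<Prod>v\<in>UNIV. \<sigma> v ^ Poly_Mapping.lookup m v)"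
  by (simp add: poly_subst_def)

lemma poly_subst_zero [simp]: "poly_subst \<sigma> 0 = 0"
  by (simp add: poly_subst_def)

lemma poly_subst_const [simp]: "poly_subst \<sigma> (Poly_Mapping.single 0 c) = Poly_Mapping.single 0 c"
  by (simp add: poly_subst_single)

lemma poly_subst_one [simp]: "poly_subst \<sigma> 1 = 1"
  using poly_subst_const[of \<sigma> 1] by simp

lemma poly_subst_add [simp]: "poly_subst \<sigma> (p + q) = poly_subst \<sigma> p + poly_subst \<sigma> q"
  unfolding poly_subst_def
  \<comment> \<open>Cancellation may leave \<open>p + q\<close> with fewer keys than
    \<open>p\<close> and \<open>q\<close> have together; the sums still match because each term is
    additive in its coefficient and vanishes for coefficient \<open>0\<close>.\<close>
  by (rule setsum_keys_plus_distrib) (simp_all add: single_add distrib_right)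

lemma poly_subst_mult [simp]: "poly_subst \<sigma> (p * q) = poly_subst \<sigma> p * poly_subst \<sigma> q"
proof (induction p rule: poly_mapping_single_induct)
  case (single m c)
  show ?case
  proof (induction q rule: poly_mapping_single_induct)
    case (single n d)
    have "Poly_Mapping.single 0 (c * d) = Poly_Mapping.single (0 :: 'a \<Rightarrow>\<^sub>0 nat) c * Poly_Mapping.single 0 d"
      by (simp add: mult_single)
    moreover have "poly_subst \<sigma> (Poly_Mapping.single m c * Poly_Mapping.single n d)
        = Poly_Mapping.single 0 (c * d) * (\<Prod>v\<in>UNIV. \<sigma> v ^ Poly_Mapping.lookup (m + n) v)"
      by (simp only: mult_single poly_subst_single)
    ultimately show ?case
      by (simp only: poly_subst_single lookup_add power_add prod.distrib mult_ac)
  qed (simp_all add: distrib_left)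
qed (simp_all add: distrib_right)

lemma poly_subst_uminus [simp]:
  "poly_subst \<sigma> (- p :: ('a::finite \<Rightarrow>\<^sub>0 nat) \<Rightarrow>\<^sub>0 'b::comm_ring_1) = - poly_subst \<sigma> p"
proof -
  have "poly_subst \<sigma> p + poly_subst \<sigma> (- p) = 0"
    by (subst poly_subst_add[symmetric]) simp
  then show ?thesis by (simp add: eq_neg_iff_add_eq_0 add.commute)
qed

lemma poly_subst_diff [simp]:
  "poly_subst \<sigma> (p - q :: ('a::finite \<Rightarrow>\<^sub>0 nat) \<Rightarrow>\<^sub>0 'b::comm_ring_1) = poly_subst \<sigma> p - poly_subst \<sigma> q"
  using poly_subst_add[of \<sigma> p "- q"] by (simp del: poly_subst_add)

lemma poly_subst_power [simp]: "poly_subst \<sigma> (p ^ n) = poly_subst \<sigma> p ^ n"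
  by (induction n) simp_all

lemma poly_subst_var [simp]:
  "poly_subst \<sigma> (Poly_Mapping.single (Poly_Mapping.single v 1) 1) = \<sigma> v"
proof -
  have "(\<Prod>w\<in>UNIV. \<sigma> w ^ Poly_Mapping.lookup (Poly_Mapping.single v 1) w)
      = (\<Prod>w\<in>UNIV. if w = v then \<sigma> w else 1)"
    by (rule prod.cong) (auto simp: lookup_single when_def)
  then show ?thesis by (simp add: poly_subst_single)
qed

lemma poly_subst_poly_subst:
  "poly_subst \<sigma> (poly_subst \<tau> p) = poly_subst (\<lambda>v. poly_subst \<sigma> (\<tau> v)) p"
  by (induction p rule: poly_var_induct) (simp_all del: One_nat_def)

section \<open>The ring R\<close>

instance indet :: finite
proof
  have *: "(UNIV :: indet set) = {Ix1, Ix2, Ir, Ia, Ib, Ic, Id}"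
    by (auto intro: indet.exhaust)
  show "finite (UNIV :: indet set)" unfolding * by simp
qed

text \<open>The order on the variables is irrelevant; it yields a monomial order, and hence that the
  polynomial ring is a domain.\<close>

instantiation indet :: linorder
begin

primrec indet_rank :: "indet \<Rightarrow> nat" where
  "indet_rank Ix1 = 0" | "indet_rank Ix2 = 1" | "indet_rank Ir = 2" | "indet_rank Ia = 3"
| "indet_rank Ib = 4" | "indet_rank Ic = 5" | "indet_rank Id = 6"

definition less_eq_indet :: "indet \<Rightarrow> indet \<Rightarrow> bool"
  where "less_eq_indet v w \<longleftrightarrow> indet_rank v \<le> indet_rank w"

definition less_indet :: "indet \<Rightarrow> indet \<Rightarrow> bool"
  where "less_indet v w \<longleftrightarrow> indet_rank v < indet_rank w"

instance
proof
  fix v w :: indet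
  assume "v \<le> w" "w \<le> v"
  then have "indet_rank v = indet_rank w" by (simp add: less_eq_indet_def)
  then show "v = w" by (cases v; cases w) simp_all
qed (auto simp: less_eq_indet_def less_indet_def)

end

lemma noetherian_ring_D_ring: "noetherian_ring D_ring"
  unfolding D_ring_def by (rule hilbert_basis)

lemma poly_subst_Var [simp]: "poly_subst \<sigma> (Var v) = \<sigma> v"
  unfolding Var_def by (rule poly_subst_var)

lemma poly7_induct [case_names const Var add mult]:
  assumes "\<And>c. P (Poly_Mapping.single 0 c)" "\<And>v. P (Var v)"
    "\<And>p q. P p \<Longrightarrow> P q \<Longrightarrow> P (p + q)" "\<And>p q. P p \<Longrightarrow> P q \<Longrightarrow> P (p * q)"
  shows "P (p :: poly7)"
  using assms unfolding Var_def by (rule poly_var_induct)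

lemma Var_neq_0 [simp]: "Var v \<noteq> 0"
proof
  assume "Var v = 0"
  then have "Poly_Mapping.lookup (Var v) (Poly_Mapping.single v 1) = 0" by simp
  then show False by (simp add: Var_def del: One_nat_def)
qed

section \<open>The three components of \<open>R\<close>\<close>

abbreviation "x1 \<equiv> Var Ix1"
abbreviation "x2 \<equiv> Var Ix2"
abbreviation "r \<equiv> Var Ir"
abbreviation "a \<equiv> Var Ia"
abbreviation "b \<equiv> Var Ib"
abbreviation "c \<equiv> Var Ic"
abbreviation "d \<equiv> Var Id"

text \<open>Each map restricts to one component. \<open>\<pi>\<^sub>1\<close> is the locus
  \<open>r = a = 0\<close>. Where \<open>r + a\<close> is nonzero, the relations force
  \<open>a = r\<close>, \<open>x1 = c\<close>, \<open>x2 = b\<close>, which is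
  \<open>\<pi>\<^sub>2\<close>; where \<open>r - a\<close> is nonzero they force the same with
  opposite signs, which is \<open>\<pi>\<^sub>3\<close>. The value of \<open>d\<close> is that of
  \<open>c * x2 - b * x1\<close>.\<close>

definition \<pi>\<^sub>1 :: "poly7 \<Rightarrow> poly7" where
  "\<pi>\<^sub>1 = poly_subst (\<lambda>v. case v of Ir \<Rightarrow> 0 | Ia \<Rightarrow> 0 | Id \<Rightarrow> c * x2 - b * x1 | _ \<Rightarrow> Var v)"

definition \<pi>\<^sub>2 :: "poly7 \<Rightarrow> poly7" where
  "\<pi>\<^sub>2 = poly_subst (\<lambda>v. case v of Ix1 \<Rightarrow> c | Ix2 \<Rightarrow> b | Ia \<Rightarrow> r | Id \<Rightarrow> 0 | _ \<Rightarrow> Var v)"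

definition \<pi>\<^sub>3 :: "poly7 \<Rightarrow> poly7" where
  "\<pi>\<^sub>3 = poly_subst (\<lambda>v. case v of Ix1 \<Rightarrow> - c | Ix2 \<Rightarrow> - b | Ia \<Rightarrow> - r | Id \<Rightarrow> 0 | _ \<Rightarrow> Var v)"

lemmas \<pi>_defs = \<pi>\<^sub>1_def \<pi>\<^sub>2_def \<pi>\<^sub>3_def

lemma ideal_I: "ideal I_ideal ring_of_type_algebra"
proof -
  interpret ring "ring_of_type_algebra :: poly7 ring" by (rule ring_from_type_algebra)
  show ?thesis
    unfolding I_ideal_def Let_def D_ring_def by (rule genideal_ideal) simp
qed

lemmas I_closed = ideal_ring_of_type_algebraD[OF ideal_I]

lemma I_gens:
  "c * r - a * x1 \<in> I_ideal" "c * x2 - d - b * x1 \<in> I_ideal" "r * d \<in> I_ideal"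
  "a * x2 - b * r \<in> I_ideal" "c * a - r * x1 \<in> I_ideal" "r\<^sup>2 - a\<^sup>2 \<in> I_ideal"
  "r * x2 - a * b \<in> I_ideal"
proof -
  interpret ring "ring_of_type_algebra :: poly7 ring" by (rule ring_from_type_algebra)
  have "{c * r - a * x1, c * x2 - d - b * x1, r * d, a * x2 - b * r, c * a - r * x1,
      r\<^sup>2 - a\<^sup>2, r * x2 - a * b} \<subseteq> I_ideal"
    unfolding I_ideal_def Let_def D_ring_def by (rule genideal_self) simp
  then show "c * r - a * x1 \<in> I_ideal" "c * x2 - d - b * x1 \<in> I_ideal" "r * d \<in> I_ideal"
    "a * x2 - b * r \<in> I_ideal" "c * a - r * x1 \<in> I_ideal" "r\<^sup>2 - a\<^sup>2 \<in> I_ideal"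
    "r * x2 - a * b \<in> I_ideal" by simp_all
qed

lemma poly_subst_ideal_eq_0:
  assumes "f \<in> I_ideal"
    and "\<forall>g\<in>{c * r - a * x1, c * x2 - d - b * x1, r * d, a * x2 - b * r, c * a - r * x1,
      r\<^sup>2 - a\<^sup>2, r * x2 - a * b}. poly_subst \<sigma> g = 0"
  shows "poly_subst \<sigma> f = 0"
proof -
  interpret ring "ring_of_type_algebra :: poly7 ring" by (rule ring_from_type_algebra)
  have "subgroup {f. poly_subst \<sigma> f = 0} (add_monoid (ring_of_type_algebra :: poly7 ring))"
    by (rule add.subgroupI) (auto simp: a_inv_def[symmetric] intro: exI[of _ 0])
  then have "ideal {f. poly_subst \<sigma> f = 0} (ring_of_type_algebra :: poly7 ring)"
    by (intro idealI ring_axioms) auto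
  then have "I_ideal \<subseteq> {f. poly_subst \<sigma> f = 0}"
    unfolding I_ideal_def Let_def D_ring_def
    by (rule genideal_minimal) (use assms(2) in blast)
  with assms(1) show ?thesis by blast
qed

lemma \<pi>_I_eq_0:
  assumes "f \<in> I_ideal"
  shows "\<pi>\<^sub>1 f = 0" "\<pi>\<^sub>2 f = 0" "\<pi>\<^sub>3 f = 0"
  unfolding \<pi>_defs using assms
  by (rule poly_subst_ideal_eq_0; simp add: algebra_simps power2_eq_square)+

text \<open>The polynomials that \<open>t\<close> multiplies into \<open>I\<close> form an ideal,
  and modulo it the substitution is the identity as soon as it is so on variables. For products use
  \<open>pq - p'q' = q (p - p') + p' (q - q')\<close>.\<close>

lemma mult_diff_poly_subst_in_I:
  assumes "\<And>v. t * (Var v - \<sigma> v) \<in> I_ideal"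
  shows "t * (f - poly_subst \<sigma> f) \<in> I_ideal"
proof (induction f rule: poly7_induct)
  case (const q)
  then show ?case by (simp add: I_closed)
next
  case (Var v)
  then show ?case using assms by simp
next
  case (add p q)
  then have "t * (p - poly_subst \<sigma> p) + t * (q - poly_subst \<sigma> q) \<in> I_ideal" by (rule I_closed)
  then show ?case by (simp add: algebra_simps)
next
  case (mult p q)
  then have "q * (t * (p - poly_subst \<sigma> p)) + poly_subst \<sigma> p * (t * (q - poly_subst \<sigma> q)) \<in> I_ideal"
    by (intro I_closed(2) I_closed(5)[of _ q] I_closed(5)[of _ "poly_subst \<sigma> p"])
  then show ?case by (simp add: algebra_simps)
qed

text \<open>Only \<open>r * d\<close> is among the generators; together with \<open>a * d\<close> it
  shows that both \<open>r + a\<close> and \<open>r - a\<close> annihilate \<open>d\<close>.\<close>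

lemma a_mult_d_in_I: "a * d \<in> I_ideal"
proof -
  have "x2 * (c * a - r * x1) + x1 * (r * x2 - a * b) - a * (c * x2 - d - b * x1) \<in> I_ideal"
    by (intro I_closed(2,3,5) I_gens)
  then show ?thesis by (simp add: algebra_simps)
qed

lemma r_plus_a_mult: "(r + a) * (f - \<pi>\<^sub>2 f) \<in> I_ideal"
  unfolding \<pi>\<^sub>2_def
proof (rule mult_diff_poly_subst_in_I)
  fix v
  \<comment> \<open>These are \<open>r + a\<close> times \<open>x1 - c\<close>,
    \<open>x2 - b\<close>, \<open>a - r\<close> and \<open>d\<close>, one for each variable that
    \<open>\<pi>\<^sub>2\<close> moves.\<close>
  have "- ((c * a - r * x1) + (c * r - a * x1)) \<in> I_ideal"
    "(r * x2 - a * b) + (a * x2 - b * r) \<in> I_ideal" "- (r\<^sup>2 - a\<^sup>2) \<in> I_ideal"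
    "r * d + a * d \<in> I_ideal"
    by (intro I_closed(2,4) I_gens a_mult_d_in_I)+
  then show "(r + a) * (Var v - (case v of Ix1 \<Rightarrow> c | Ix2 \<Rightarrow> b | Ia \<Rightarrow> r | Id \<Rightarrow> 0 | _ \<Rightarrow> Var v)) \<in> I_ideal"
    by (cases v) (simp_all add: I_closed algebra_simps power2_eq_square)
qed

lemma r_minus_a_mult: "(r - a) * (f - \<pi>\<^sub>3 f) \<in> I_ideal"
  unfolding \<pi>\<^sub>3_def
proof (rule mult_diff_poly_subst_in_I)
  fix v
  have "(c * r - a * x1) - (c * a - r * x1) \<in> I_ideal"
    "(r * x2 - a * b) - (a * x2 - b * r) \<in> I_ideal" "r\<^sup>2 - a\<^sup>2 \<in> I_ideal"
    "r * d - a * d \<in> I_ideal"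
    by (intro I_closed(3) I_gens a_mult_d_in_I)+
  then show "(r - a) * (Var v - (case v of Ix1 \<Rightarrow> - c | Ix2 \<Rightarrow> - b | Ia \<Rightarrow> - r | Id \<Rightarrow> 0 | _ \<Rightarrow> Var v)) \<in> I_ideal"
    by (cases v) (simp_all add: I_closed algebra_simps power2_eq_square)
qed

text \<open>\<open>\<pi>\<^sub>1\<close> moves only \<open>r\<close>, \<open>a\<close> and
  \<open>d\<close>, and its change of \<open>d\<close> is already a relation in
  \<open>I\<close>.\<close>

lemma diff_\<pi>\<^sub>1_in_I_plus:
  "\<exists>h k. f - \<pi>\<^sub>1 f - (r * h + a * k) \<in> I_ideal"
proof (induction f rule: poly7_induct)
  case (const q)
  have "Poly_Mapping.single 0 q - \<pi>\<^sub>1 (Poly_Mapping.single 0 q) - (r * 0 + a * 0) \<in> I_ideal"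
    by (simp add: I_closed \<pi>\<^sub>1_def)
  then show ?case by blast
next
  case (Var v)
  have "d - (c * x2 - b * x1) \<in> I_ideal"
    using I_closed(4)[OF I_gens(2)] by (simp add: algebra_simps)
  then have "Var v - \<pi>\<^sub>1 (Var v) - (r * (if v = Ir then 1 else 0) + a * (if v = Ia then 1 else 0)) \<in> I_ideal"
    by (cases v) (simp_all add: \<pi>\<^sub>1_def I_closed)
  then show ?case by blast
next
  case (add p q)
  then obtain h k h' k' where "p - \<pi>\<^sub>1 p - (r * h + a * k) \<in> I_ideal"
    "q - \<pi>\<^sub>1 q - (r * h' + a * k') \<in> I_ideal" by blast
  then have "p - \<pi>\<^sub>1 p - (r * h + a * k) + (q - \<pi>\<^sub>1 q - (r * h' + a * k')) \<in> I_ideal"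
    by (rule I_closed)
  also have "p - \<pi>\<^sub>1 p - (r * h + a * k) + (q - \<pi>\<^sub>1 q - (r * h' + a * k'))
      = p + q - \<pi>\<^sub>1 (p + q) - (r * (h + h') + a * (k + k'))"
    by (simp add: \<pi>\<^sub>1_def algebra_simps)
  finally show ?case by blast
next
  case (mult p q)
  then obtain h k h' k' where "p - \<pi>\<^sub>1 p - (r * h + a * k) \<in> I_ideal"
    "q - \<pi>\<^sub>1 q - (r * h' + a * k') \<in> I_ideal" by blast
  then have "q * (p - \<pi>\<^sub>1 p - (r * h + a * k)) + \<pi>\<^sub>1 p * (q - \<pi>\<^sub>1 q - (r * h' + a * k')) \<in> I_ideal"
    by (intro I_closed(2,5))
  also have "q * (p - \<pi>\<^sub>1 p - (r * h + a * k)) + \<pi>\<^sub>1 p * (q - \<pi>\<^sub>1 q - (r * h' + a * k'))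
      = p * q - \<pi>\<^sub>1 (p * q) - (r * (q * h + \<pi>\<^sub>1 p * h') + a * (q * k + \<pi>\<^sub>1 p * k'))"
    by (simp add: \<pi>\<^sub>1_def algebra_simps)
  finally show ?case by blast
qed

lemma half: "Poly_Mapping.single 0 (1 / 2) * (p + p :: poly7) = p"
proof -
  have "Poly_Mapping.single 0 (1 / 2) * (p + p)
      = (Poly_Mapping.single 0 (1 / 2) + Poly_Mapping.single 0 (1 / 2)) * p"
    by (simp only: distrib_left distrib_right)
  also have "\<dots> = p" by (simp flip: single_add)
  finally show ?thesis .
qed

text \<open>As a vector space, \<open>R\<close> is the direct sum of \<open>\<rat>[x\<^sub>1, x\<^sub>2, b, c]\<close>, \<open>(r + a) \<rat>[r, b, c]\<close> and
  \<open>(r - a) \<rat>[r, b, c]\<close>.\<close>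

lemma I_decomposition:
  "\<exists>h k. f - \<pi>\<^sub>1 f - (r + a) * \<pi>\<^sub>2 h - (r - a) * \<pi>\<^sub>3 k \<in> I_ideal"
proof -
  obtain u v where uv: "f - \<pi>\<^sub>1 f - (r * u + a * v) \<in> I_ideal"
    using diff_\<pi>\<^sub>1_in_I_plus by blast
  \<comment> \<open>The solution of \<open>r u + a v = (r + a) h + (r - a) k\<close>, where
    \<open>u\<close> and \<open>v\<close> are the cofactors just obtained. Afterwards
    \<open>h\<close> and \<open>k\<close> may be replaced by \<open>\<pi>\<^sub>2 h\<close> and
    \<open>\<pi>\<^sub>3 k\<close>, since \<open>r + a\<close> and \<open>r - a\<close> do not see
    the difference modulo \<open>I\<close>.\<close>
  define h k where "h = Poly_Mapping.single 0 (1 / 2) * (u + v)"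
    and "k = Poly_Mapping.single 0 (1 / 2) * (u - v)"
  have "h + h = u + v" "k + k = u - v"
    unfolding h_def k_def by (simp_all only: half flip: distrib_left)
  then have "(h + k) + (h + k) = u + u" "(h - k) + (h - k) = v + v" by (simp_all add: algebra_simps)
  then have u: "u = h + k" and v: "v = h - k" using half by metis+
  have "(f - \<pi>\<^sub>1 f - (r * u + a * v)) + (r + a) * (h - \<pi>\<^sub>2 h) + (r - a) * (k - \<pi>\<^sub>3 k) \<in> I_ideal"
    by (intro I_closed(2) uv r_plus_a_mult r_minus_a_mult)
  also have "(f - \<pi>\<^sub>1 f - (r * u + a * v)) + (r + a) * (h - \<pi>\<^sub>2 h) + (r - a) * (k - \<pi>\<^sub>3 k)
      = f - \<pi>\<^sub>1 f - (r + a) * \<pi>\<^sub>2 h - (r - a) * \<pi>\<^sub>3 k"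
    unfolding u v by (simp add: algebra_simps)
  finally show ?thesis by blast
qed

lemma \<pi>_hom [simp]:
  "\<pi>\<^sub>1 (f + g) = \<pi>\<^sub>1 f + \<pi>\<^sub>1 g" "\<pi>\<^sub>1 (f - g) = \<pi>\<^sub>1 f - \<pi>\<^sub>1 g" "\<pi>\<^sub>1 (f * g) = \<pi>\<^sub>1 f * \<pi>\<^sub>1 g"
  "\<pi>\<^sub>2 (f + g) = \<pi>\<^sub>2 f + \<pi>\<^sub>2 g" "\<pi>\<^sub>2 (f - g) = \<pi>\<^sub>2 f - \<pi>\<^sub>2 g" "\<pi>\<^sub>2 (f * g) = \<pi>\<^sub>2 f * \<pi>\<^sub>2 g"
  "\<pi>\<^sub>3 (f + g) = \<pi>\<^sub>3 f + \<pi>\<^sub>3 g" "\<pi>\<^sub>3 (f - g) = \<pi>\<^sub>3 f - \<pi>\<^sub>3 g" "\<pi>\<^sub>3 (f * g) = \<pi>\<^sub>3 f * \<pi>\<^sub>3 g"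
  by (simp_all add: \<pi>_defs)

lemma \<pi>_simps [simp]:
  "\<pi>\<^sub>1 b = b" "\<pi>\<^sub>1 c = c" "\<pi>\<^sub>1 r = 0" "\<pi>\<^sub>1 a = 0"
  "\<pi>\<^sub>2 b = b" "\<pi>\<^sub>2 c = c" "\<pi>\<^sub>2 r = r" "\<pi>\<^sub>2 a = r"
  "\<pi>\<^sub>3 b = b" "\<pi>\<^sub>3 c = c" "\<pi>\<^sub>3 r = r" "\<pi>\<^sub>3 a = - r"
  by (simp_all add: \<pi>_defs)

lemma \<pi>_idem [simp]: "\<pi>\<^sub>2 (\<pi>\<^sub>2 f) = \<pi>\<^sub>2 f" "\<pi>\<^sub>3 (\<pi>\<^sub>3 f) = \<pi>\<^sub>3 f"
  unfolding \<pi>_defs poly_subst_poly_subst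
  by (rule arg_cong2[of _ _ _ _ poly_subst]; simp add: fun_eq_iff split: indet.split)+

text \<open>Applying \<open>\<pi>\<^sub>2\<close> to the splitting kills \<open>r - a\<close> and
  turns \<open>r + a\<close> into \<open>2 r\<close>; \<open>\<pi>\<^sub>3\<close> does the reverse.
  As \<open>D\<close> is a domain, the two equations determine \<open>h\<close> and
  \<open>k\<close>.\<close>

lemma I_decompositionE:
  obtains h k where "f - \<pi>\<^sub>1 f - (r + a) * h - (r - a) * k \<in> I_ideal"
    "\<pi>\<^sub>2 f - \<pi>\<^sub>2 (\<pi>\<^sub>1 f) = (r + r) * h" "\<pi>\<^sub>3 f - \<pi>\<^sub>3 (\<pi>\<^sub>1 f) = (r + r) * k"
proof -
  obtain h k where hk: "f - \<pi>\<^sub>1 f - (r + a) * \<pi>\<^sub>2 h - (r - a) * \<pi>\<^sub>3 k \<in> I_ideal"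
    using I_decomposition by blast
  with \<pi>_I_eq_0(2,3)[OF hk] show ?thesis using that by simp
qed

lemma r_plus_r_neq_0: "r + r \<noteq> 0"
  by (simp flip: mult_2)

lemma in_I_iff: "f \<in> I_ideal \<longleftrightarrow> \<pi>\<^sub>1 f = 0 \<and> \<pi>\<^sub>2 f = 0 \<and> \<pi>\<^sub>3 f = 0"
proof
  assume 0: "\<pi>\<^sub>1 f = 0 \<and> \<pi>\<^sub>2 f = 0 \<and> \<pi>\<^sub>3 f = 0"
  obtain h k where hk: "f - \<pi>\<^sub>1 f - (r + a) * h - (r - a) * k \<in> I_ideal"
    "\<pi>\<^sub>2 f - \<pi>\<^sub>2 (\<pi>\<^sub>1 f) = (r + r) * h" "\<pi>\<^sub>3 f - \<pi>\<^sub>3 (\<pi>\<^sub>1 f) = (r + r) * k"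
    using I_decompositionE .
  have "\<pi>\<^sub>2 0 = 0" "\<pi>\<^sub>3 0 = 0" by (simp_all add: \<pi>_defs)
  then have "h = 0" "k = 0" using 0 hk(2,3) r_plus_r_neq_0 by auto
  with hk(1) 0 show "f \<in> I_ideal" by simp
qed (simp add: \<pi>_I_eq_0)

section \<open>\<open>c\<close>, \<open>b\<close> is a regular sequence on \<open>R\<close>\<close>

lemma c_regular: "c * f \<in> I_ideal \<Longrightarrow> f \<in> I_ideal"
  by (simp add: in_I_iff)

text \<open>Reduction modulo \<open>c\<close>: its kernel is the ideal \<open>c D\<close> and its
  values lie in a domain, so it serves to use that \<open>c\<close> is prime in
  \<open>D\<close>.\<close>

definition eval_c_0 :: "poly7 \<Rightarrow> poly7"
  where "eval_c_0 = poly_subst (\<lambda>v. if v = Ic then 0 else Var v)"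

lemma c_dvd_diff_eval: "c dvd f - eval_c_0 f"
proof (induction f rule: poly7_induct)
  case (mult p q)
  then have "c dvd q * (p - eval_c_0 p) + eval_c_0 p * (q - eval_c_0 q)" by (intro dvd_add dvd_mult)
  then show ?case by (simp add: eval_c_0_def algebra_simps)
next
  case (add p q)
  from dvd_add[OF this] show ?case by (simp add: eval_c_0_def algebra_simps)
qed (simp_all add: eval_c_0_def)

lemma c_dvd_multD:
  assumes "c dvd t * f" and "eval_c_0 t \<noteq> 0"
  shows "c dvd f"
proof -
  obtain g where "t * f = c * g" using assms(1) by (auto simp: dvd_def)
  then have "eval_c_0 (t * f) = eval_c_0 (c * g)" by simp
  also have "\<dots> = 0" by (simp add: eval_c_0_def)
  finally have "eval_c_0 f = 0" using assms(2) by (simp add: eval_c_0_def)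
  with c_dvd_diff_eval[of f] show ?thesis by simp
qed

lemma b_regular_mod_c:
  assumes "b * f - c * g \<in> I_ideal"
  shows "\<exists>h. f - c * h \<in> I_ideal"
proof -
  have eq: "b * \<pi>\<^sub>1 f = c * \<pi>\<^sub>1 g" "b * \<pi>\<^sub>2 f = c * \<pi>\<^sub>2 g" "b * \<pi>\<^sub>3 f = c * \<pi>\<^sub>3 g"
    using \<pi>_I_eq_0[OF assms] by simp_all
  have "eval_c_0 b \<noteq> 0" by (simp add: eval_c_0_def)
  then have "c dvd \<pi>\<^sub>1 f" "c dvd \<pi>\<^sub>2 f" "c dvd \<pi>\<^sub>3 f"
    using c_dvd_multD dvd_triv_left eq by metis+
  then obtain f1 f2 f3 where f: "\<pi>\<^sub>1 f = c * f1" "\<pi>\<^sub>2 f = c * f2" "\<pi>\<^sub>3 f = c * f3"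
    by (auto simp: dvd_def)
  obtain h k where hk: "f - \<pi>\<^sub>1 f - (r + a) * h - (r - a) * k \<in> I_ideal"
    "\<pi>\<^sub>2 f - \<pi>\<^sub>2 (\<pi>\<^sub>1 f) = (r + r) * h" "\<pi>\<^sub>3 f - \<pi>\<^sub>3 (\<pi>\<^sub>1 f) = (r + r) * k"
    using I_decompositionE .
  \<comment> \<open>Divisibility of the three images by \<open>c\<close> passes to
    \<open>2 r h\<close> and \<open>2 r k\<close>, hence to \<open>h\<close> and \<open>k\<close>,
    because \<open>2 r\<close> is nonzero modulo \<open>c\<close>. The three quotients then
    recombine into one element.\<close>
  have "c * (f2 - \<pi>\<^sub>2 f1) = (r + r) * h" "c * (f3 - \<pi>\<^sub>3 f1) = (r + r) * k"
    using hk(2,3) by (simp_all add: f right_diff_distrib)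
  then have "c dvd (r + r) * h" "c dvd (r + r) * k" using dvd_triv_left by metis+
  moreover have "eval_c_0 r = r" by (simp add: eval_c_0_def)
  then have "eval_c_0 (r + r) \<noteq> 0" using r_plus_r_neq_0 by (metis eval_c_0_def poly_subst_add)
  ultimately obtain h' k' where "h = c * h'" "k = c * k'"
    using c_dvd_multD by (metis dvd_def)
  with hk(1) f(1) have "f - c * (f1 + (r + a) * h' + (r - a) * k') \<in> I_ideal"
    by (simp add: algebra_simps)
  then show ?thesis by blast
qed

text \<open>Cancelling \<open>r\<close> in the images of \<open>a = h r\<close> gives
  \<open>\<pi>\<^sub>2 h = 1\<close> and \<open>\<pi>\<^sub>3 h = -1\<close>. Both maps send
  variables to polynomials without constant term, so evaluation \<open>e\<close> at the origin takes
  the same value on the two images, and \<open>1 = -1\<close> follows.\<close>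

lemma a_notin_r_plus_I: "a - h * r \<notin> I_ideal"
proof
  define e :: "poly7 \<Rightarrow> poly7" where "e = poly_subst (\<lambda>_. 0)"
  have e: "e (\<pi>\<^sub>2 f) = e f" "e (\<pi>\<^sub>3 f) = e f" for f
    unfolding e_def \<pi>_defs poly_subst_poly_subst
    by (rule arg_cong2[of _ _ _ _ poly_subst]; simp add: fun_eq_iff split: indet.split)+
  assume "a - h * r \<in> I_ideal"
  then have "r = \<pi>\<^sub>2 h * r" "- r = \<pi>\<^sub>3 h * r" using \<pi>_I_eq_0(2,3) by fastforce+
  then have "\<pi>\<^sub>2 h = 1" "\<pi>\<^sub>3 h = - 1"
    by (metis Var_neq_0 mult_cancel_right1, metis Var_neq_0 mult_minus1 mult_cancel_right)
  then have "e h = 1" "e h = - 1" using e[of h] by (simp_all add: e_def)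
  then have "(1 :: poly7) + 1 = 0" by simp
  then show False by simp
qed

section \<open>Passage from polynomials to residue classes, and the conclusion\<close>

theorem mainTheorem2:
  shows "noetherian_ring R_ring \<and> \<not> w_ideal R_ring (PIdl\<^bsub>R_ring\<^esub> r_bar)"
proof
  have idI: "ideal I_ideal D_ring" unfolding D_ring_def by (rule ideal_I)
  show "noetherian_ring R_ring"
    unfolding R_ring_def by (rule noetherian_ring_Quot[OF noetherian_ring_D_ring idI])
  interpret D: cring D_ring unfolding D_ring_def by (rule cring_from_type_algebra)
  interpret R: cring R_ring
    unfolding R_ring_def by (rule ideal.quotient_is_cring[OF idI D.is_cring])
  define q where "q f = I_ideal +>\<^bsub>D_ring\<^esub> f" for f
  have q_hom: "q \<in> ring_hom D_ring R_ring"
    unfolding q_def R_ring_def by (rule ideal.rcos_ring_hom[OF idI])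
  have q_mult: "q f \<otimes>\<^bsub>R_ring\<^esub> q g = q (f * g)" for f g
    using ring_hom_mult[OF q_hom, of f g] by (simp add: D_ring_def)
  have carR: "carrier R_ring = Set.range q"
    unfolding R_ring_def FactRing_def q_def using A_RCOSETS_def'[of D_ring I_ideal]
    by (auto simp: D_ring_def)
  have q_eq: "q f = q g \<longleftrightarrow> f - g \<in> I_ideal" for f g
    using D.quotient_eq_iff_same_a_r_cos[OF idI, of f g]
    by (simp add: q_def D_ring_def a_minus_def)
  have zeroR: "\<zero>\<^bsub>R_ring\<^esub> = q 0"
    using I_closed(1) D.a_rcos_zero[OF idI, of 0] by (simp add: R_ring_def FactRing_def q_def)
  have q_car: "q f \<in> carrier R_ring" for f by (simp add: carR)
  have J_gens: "{q b, q c} \<subseteq> carrier R_ring" using q_car by simp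
  let ?J = "Idl\<^bsub>R_ring\<^esub> {q b, q c}" and ?K = "PIdl\<^bsub>R_ring\<^esub> q r"
  have J: "?J \<in> GV R_ring"
  proof (rule R.GV_regular_sequenceI[of _ "{q b, q c}" "q b" "q c"])
    show "ideal ?J R_ring" by (rule R.genideal_ideal[OF J_gens])
    show "q b \<in> ?J" "q c \<in> ?J" using R.genideal_self[OF J_gens] by auto
  next
    fix x assume "x \<in> carrier R_ring" and x0: "q c \<otimes>\<^bsub>R_ring\<^esub> x = \<zero>\<^bsub>R_ring\<^esub>"
    then obtain f where f: "x = q f" by (auto simp: carR)
    with x0 have "c * f \<in> I_ideal" by (simp add: q_mult zeroR q_eq)
    from c_regular[OF this] show "x = \<zero>\<^bsub>R_ring\<^esub>" by (simp add: f zeroR q_eq)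
  next
    fix x y assume "x \<in> carrier R_ring" "y \<in> carrier R_ring"
      and xy: "q b \<otimes>\<^bsub>R_ring\<^esub> x = q c \<otimes>\<^bsub>R_ring\<^esub> y"
    then obtain f g where fg: "x = q f" "y = q g" by (auto simp: carR)
    with xy have "b * f - c * g \<in> I_ideal" by (simp add: q_mult q_eq)
    then obtain h where "f - c * h \<in> I_ideal" using b_regular_mod_c by blast
    then show "\<exists>z\<in>carrier R_ring. x = q c \<otimes>\<^bsub>R_ring\<^esub> z"
      using q_car by (intro bexI[of _ "q h"]) (simp_all add: fg q_mult q_eq)
  qed (use J_gens in simp_all)
  have idK: "ideal ?K R_ring" by (rule R.cgenideal_ideal[OF q_car])
  have r_mult: "q f \<in> ?K" if "f - g * r \<in> I_ideal" for f g
    using that q_eq[of f "g * r"] q_car by (auto simp: cgenideal_def q_mult[symmetric])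
  \<comment> \<open>The elements that \<open>q a\<close> multiplies into \<open>?K\<close> form an
    ideal, so it suffices to test \<open>q b\<close> and \<open>q c\<close>; their multipliers
    \<open>x2\<close> and \<open>x1\<close> come from the generators \<open>r * x2 - a * b\<close>
    and \<open>c * a - r * x1\<close>.\<close>
  have "?J \<subseteq> {x \<in> carrier R_ring. q a \<otimes>\<^bsub>R_ring\<^esub> x \<in> ?K}"
  proof (rule R.genideal_minimal)
    show "ideal {x \<in> carrier R_ring. q a \<otimes>\<^bsub>R_ring\<^esub> x \<in> ?K} R_ring"
      by (rule ideal.helper_max_prime[OF idK R.is_cring q_car])
    have "a * b - x2 * r \<in> I_ideal" "a * c - x1 * r \<in> I_ideal"
      using I_closed(4)[OF I_gens(7)] I_gens(5) by (simp_all add: mult.commute)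
    then have "q (a * b) \<in> ?K" "q (a * c) \<in> ?K" by (auto intro: r_mult)
    then show "{q b, q c} \<subseteq> {x \<in> carrier R_ring. q a \<otimes>\<^bsub>R_ring\<^esub> x \<in> ?K}"
      using q_car by (simp add: q_mult)
  qed
  then have aJ: "q a \<otimes>\<^bsub>R_ring\<^esub> j \<in> ?K" if "j \<in> ?J" for j using that by blast
  show "\<not> w_ideal R_ring (PIdl\<^bsub>R_ring\<^esub> r_bar)"
  proof
    assume "w_ideal R_ring (PIdl\<^bsub>R_ring\<^esub> r_bar)"
    then have "w_ideal R_ring ?K" by (simp add: r_bar_def q_def)
    from R.w_ideal_GV_closed[OF this J q_car aJ] obtain x
      where "x \<in> carrier R_ring" "q a = x \<otimes>\<^bsub>R_ring\<^esub> q r" by (auto simp: cgenideal_def)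
    then obtain h where "q a = q (h * r)" by (auto simp: carR q_mult)
    then show False using a_notin_r_plus_I by (simp add: q_eq)
  qed
qed

end
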